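(* The expressivity of the KR Logic $\mathcal{L}(\mathbf{A})$, where $\mathbf{A}$ is the set of all prime operators, is the class of regular languages (over alphabets of the form $\mathbb{B}^m$).
   Context: Write $\mathbb{B}=\{0,1\}$. Static formulas are built from propositional variables and $\top,\bot$ using $\neg,\land,\lor$. An operator automaton is $\mathcal{A}=\langle \mathbb{B}^m,[1,n],\delta,q_{\mathrm{init}}\rangle$ with $\delta:[1,n]\times\mathbb{B}^m\to[1,n]$, $q_{\mathrm{init}}\in[1,n]$. Rules: static $p \;{:}{-}\; \alpha$; delay $p \;{:}{-}\; \ominus q$; dynamic $p_1,\dots,p_n \;{:}{-}\; \mathcal{A}(a_1,\dots,a_m)$ ($\mathcal{A}$ of input arity $m$, output arity $n$). A program is a finite set of rules that is nonrecursive (the graph with an edge $a\to b$ whenever $a$ occurs in the body and $b$ in the head of a rule is acyclic) and definitorial (each variable is in at most one head). Non-defined variables are input variables; an interpretation is a finite non-empty sequence $I=I_1,\dots,I_\ell$ of subsets of input variables. Satisfaction $(P,I,t)\models\cdot$: $\top$ holds, $\bot$ not; input $a$ holds iff $a\in I_t$; Boolean connectives as usual; $p$ defined by $p\;{:}{-}\;\alpha$ iff $(P,I,t)\models\alpha$; $p$ defined by $p\;{:}{-}\;\ominus q$ iff $(P,I,t-1)\models q$; for $p_i$ defined by a dynamic rule, $(P,I,0)\models p_i$ iff $q_{\mathrm{init}}=i$, and for $t>0$, $(P,I,t)\models p_i$ iff there are $j$ and $\sigma\in\mathbb{B}^m$ (an assignment to $a_1,\dots,a_m$, identified with the conjunction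 of literals it makes true) with $\delta(j,\sigma)=i$, $(P,I,t-1)\models p_j$, $(P,I,t)\models\sigma$. For a set $\mathbf{A}$ of operator automata, the KR Logic $\mathcal{L}(\mathbf{A})$ is the set of programs consisting of static rules, delay rules and dynamic rules with operators from $\mathbf{A}$. A program with ordered input variables $x_1,\dots,x_m$ and a designated variable $a$ recognises the language of strings $\sigma_1\dots\sigma_\ell$ over $\mathbb{B}^m$ (each letter read as an assignment to the input variables, i.e. as $I_t$) such that $(P,I,\ell)\models a$; the expressivity of a logic is the set of languages its programs recognise. Semiautomata: $\langle\Sigma,Q,\delta\rangle$ with $\delta:Q\times\Sigma\to Q$; composition with an input function $\phi:\Sigma\to\Pi$ of $\langle\Pi,Q,\delta\rangle$ is $\langle\Sigma,Q,\delta_\phi\rangle$, $\delta_\phi(q,\sigma)=\delta(q,\phi(\sigma))$. $\langle\Sigma,Q,\delta\rangle$ and $\langle\Sigma',Q',\delta'\rangle$ are isomorphic if there are bijections $\psi_1:\Sigma\to\Sigma'$, $\psi_2:Q\to Q'$ with $\psi_2(\delta(q,\sigma))=\delta'(\psi_2(q),\psi_1(\sigma))$. The canonical flip-flop semiautomaton has inputs $\{set,reset,read\}$, states $\{high,low\}$, $\delta(q,read)=q$, $\delta(q,set)=high$, $\delta(q,reset)=low$. The flip-flop monoid is $\{s,r,e\}$ with identity $e$ and $x\cdot s=s$, $x\cdot r=r$ for $x\in\{s,r\}$; a semigroup $S$ defines the semiautomaton $\langle S\cup\{e\},S,(s_1,s_2)\mapsto s_1\cdot s_2\rangle$; a flip-flop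 semiautomaton is the one defined by the flip-flop monoid (the paper counts the canonical flip-flop semiautomaton as one), and a simple grouplike semiautomaton is one defined by a simple group (a group whose only normal subgroups are the trivial one and itself). A prime semiautomaton is one isomorphic to a flip-flop semiautomaton or to a simple grouplike semiautomaton. A prime operator is an operator automaton whose semiautomaton $\langle\mathbb{B}^m,[1,n],\delta\rangle$ is the composition of a surjective input function with a prime semiautomaton (its core).
   Formalization: "Regular languages" is read as regular languages not containing the empty string: interpretations are non-empty, so no program recognises a language containing it. Input and delayed variables are taken to be false at time 0. *)

theory Defs
  imports "HOL-Algebra.Coset"
begin

record ('s, 'q) semiautomaton =
  alphabet :: "'s set"
  states :: "'q set"
  trans_fun :: "'q \<Rightarrow> 's \<Rightarrow> 'q"

definition is_semiautomaton :: "('s, 'q) semiautomaton \<Rightarrow> bool" where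
  "is_semiautomaton D \<longleftrightarrow>
     (\<forall>q\<in>states D. \<forall>\<sigma>\<in>alphabet D. trans_fun D q \<sigma> \<in> states D)"

text \<open>Equality of semiautomata: transition functions are compared on their domain only.\<close>

definition same_semiautomaton ::
    "('s, 'q) semiautomaton \<Rightarrow> ('s, 'q) semiautomaton \<Rightarrow> bool" where
  "same_semiautomaton D E \<longleftrightarrow>
     alphabet D = alphabet E \<and> states D = states E \<and>
     (\<forall>q\<in>states D. \<forall>\<sigma>\<in>alphabet D. trans_fun D q \<sigma> = trans_fun E q \<sigma>)"

definition compose_input ::
    "'s set \<Rightarrow> ('s \<Rightarrow> 'p) \<Rightarrow> ('p, 'q) semiautomaton \<Rightarrow> ('s, 'q) semiautomaton" where
  "compose_input \<Sigma> \<phi> D =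
     \<lparr>alphabet = \<Sigma>, states = states D, trans_fun = (\<lambda>q \<sigma>. trans_fun D q (\<phi> \<sigma>))\<rparr>"

definition isomorphic ::
    "('s, 'q) semiautomaton \<Rightarrow> ('s2, 'q2) semiautomaton \<Rightarrow> bool" where
  "isomorphic D E \<longleftrightarrow>
     (\<exists>\<psi>1 \<psi>2. bij_betw \<psi>1 (alphabet D) (alphabet E) \<and> bij_betw \<psi>2 (states D) (states E) \<and>
        (\<forall>q\<in>states D. \<forall>\<sigma>\<in>alphabet D.
           \<psi>2 (trans_fun D q \<sigma>) = trans_fun E (\<psi>2 q) (\<psi>1 \<sigma>)))"

datatype flipflop_input = Set | Reset | Read
datatype flipflop_state = High | Low

fun flipflop_delta :: "flipflop_state \<Rightarrow> flipflop_input \<Rightarrow> flipflop_state" where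
  "flipflop_delta q Read = q"
| "flipflop_delta q Set = High"
| "flipflop_delta q Reset = Low"

definition canonical_flipflop :: "(flipflop_input, flipflop_state) semiautomaton" where
  "canonical_flipflop = \<lparr>alphabet = UNIV, states = UNIV, trans_fun = flipflop_delta\<rparr>"

datatype flipflop_elem = FS | FR | FE

fun flipflop_mult :: "flipflop_elem \<Rightarrow> flipflop_elem \<Rightarrow> flipflop_elem" where
  "flipflop_mult x FE = x"
| "flipflop_mult x FS = FS"
| "flipflop_mult x FR = FR"

definition flipflop_monoid :: "flipflop_elem monoid" where
  "flipflop_monoid = \<lparr>carrier = UNIV, monoid.mult = flipflop_mult, one = FE\<rparr>"

text \<open>The semiautomaton defined by a semigroup \<open>S\<close> has input alphabet \<open>S \<union> {e}\<close>.
  Only monoids are needed here, and for these \<open>e\<close> is the identity already present.\<close>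

definition monoid_semiautomaton :: "'a monoid \<Rightarrow> ('a, 'a) semiautomaton" where
  "monoid_semiautomaton S =
     \<lparr>alphabet = carrier S \<union> {\<one>\<^bsub>S\<^esub>}, states = carrier S,
      trans_fun = (\<lambda>s1 s2. s1 \<otimes>\<^bsub>S\<^esub> s2)\<rparr>"

text \<open>Unlike the locale \<open>simple_group\<close> of HOL-Algebra, the trivial group is not excluded.\<close>

definition is_simple_group :: "'a monoid \<Rightarrow> bool" where
  "is_simple_group G \<longleftrightarrow>
     group G \<and> (\<forall>H. H \<lhd> G \<longrightarrow> H = {\<one>\<^bsub>G\<^esub>} \<or> H = carrier G)"

text \<open>The canonical flip-flop has two states and the flip-flop monoid gives three; both count.
  The states of a grouplike semiautomaton are the group elements, so taking the
  group over the state type \<open>'q\<close> loses no semiautomaton.\<close>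

definition prime_semiautomaton :: "('s, 'q) semiautomaton \<Rightarrow> bool" where
  "prime_semiautomaton D \<longleftrightarrow> is_semiautomaton D \<and>
     (isomorphic D canonical_flipflop \<or>
      isomorphic D (monoid_semiautomaton flipflop_monoid) \<or>
      (\<exists>G :: 'q monoid. is_simple_group G \<and> isomorphic D (monoid_semiautomaton G)))"

definition bvecs :: "nat \<Rightarrow> bool list set" where
  "bvecs m = {\<sigma>. length \<sigma> = m}"

record operator_automaton =
  op_in :: nat
  op_out :: nat
  op_delta :: "nat \<Rightarrow> bool list \<Rightarrow> nat"
  op_init :: nat

definition op_semiautomaton :: "operator_automaton \<Rightarrow> (bool list, nat) semiautomaton" where
  "op_semiautomaton A =
     \<lparr>alphabet = bvecs (op_in A), states = {1..op_out A}, trans_fun = op_delta A\<rparr>"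

definition is_operator_automaton :: "operator_automaton \<Rightarrow> bool" where
  "is_operator_automaton A \<longleftrightarrow>
     is_semiautomaton (op_semiautomaton A) \<and> op_init A \<in> {1..op_out A}"

text \<open>The core alphabet is an image of the finite set \<open>bvecs (op_in A)\<close>, so natural numbers
  suffice as its letters.\<close>

definition prime_operator :: "operator_automaton \<Rightarrow> bool" where
  "prime_operator A \<longleftrightarrow> is_operator_automaton A \<and>
     (\<exists>(D :: (nat, nat) semiautomaton) \<phi>.
        prime_semiautomaton D \<and> \<phi> ` bvecs (op_in A) = alphabet D \<and>
        same_semiautomaton (op_semiautomaton A) (compose_input (bvecs (op_in A)) \<phi> D))"

type_synonym var = nat

datatype formula =
  Var var | Top | Bot | Neg formula | Conj formula formula | Disj formula formula

primrec formula_vars :: "formula \<Rightarrow> var set" where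
  "formula_vars (Var a) = {a}"
| "formula_vars Top = {}"
| "formula_vars Bot = {}"
| "formula_vars (Neg \<alpha>) = formula_vars \<alpha>"
| "formula_vars (Conj \<alpha> \<beta>) = formula_vars \<alpha> \<union> formula_vars \<beta>"
| "formula_vars (Disj \<alpha> \<beta>) = formula_vars \<alpha> \<union> formula_vars \<beta>"

primrec eval_formula :: "(var \<Rightarrow> bool) \<Rightarrow> formula \<Rightarrow> bool" where
  "eval_formula v (Var a) \<longleftrightarrow> v a"
| "eval_formula v Top \<longleftrightarrow> True"
| "eval_formula v Bot \<longleftrightarrow> False"
| "eval_formula v (Neg \<alpha>) \<longleftrightarrow> \<not> eval_formula v \<alpha>"
| "eval_formula v (Conj \<alpha> \<beta>) \<longleftrightarrow> eval_formula v \<alpha> \<and> eval_formula v \<beta>"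
| "eval_formula v (Disj \<alpha> \<beta>) \<longleftrightarrow> eval_formula v \<alpha> \<or> eval_formula v \<beta>"

datatype rule =
    Static var formula
  | Delay var var
  | Dynamic "var list" operator_automaton "var list"

primrec head_vars :: "rule \<Rightarrow> var set" where
  "head_vars (Static p \<alpha>) = {p}"
| "head_vars (Delay p q) = {p}"
| "head_vars (Dynamic ps A as) = set ps"

primrec body_vars :: "rule \<Rightarrow> var set" where
  "body_vars (Static p \<alpha>) = formula_vars \<alpha>"
| "body_vars (Delay p q) = {q}"
| "body_vars (Dynamic ps A as) = set as"

primrec wf_rule :: "rule \<Rightarrow> bool" where
  "wf_rule (Static p \<alpha>) \<longleftrightarrow> True"
| "wf_rule (Delay p q) \<longleftrightarrow> True"
| "wf_rule (Dynamic ps A as) \<longleftrightarrow>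
     is_operator_automaton A \<and> length ps = op_out A \<and> distinct ps \<and> length as = op_in A"

definition dependency :: "rule set \<Rightarrow> (var \<times> var) set" where
  "dependency P = {(a, b). \<exists>r\<in>P. a \<in> body_vars r \<and> b \<in> head_vars r}"

definition nonrecursive :: "rule set \<Rightarrow> bool" where
  "nonrecursive P \<longleftrightarrow> acyclic (dependency P)"

definition definitorial :: "rule set \<Rightarrow> bool" where
  "definitorial P \<longleftrightarrow> (\<forall>r\<in>P. \<forall>r'\<in>P. r \<noteq> r' \<longrightarrow> head_vars r \<inter> head_vars r' = {})"

definition is_program :: "rule set \<Rightarrow> bool" where
  "is_program P \<longleftrightarrow>
     finite P \<and> (\<forall>r\<in>P. wf_rule r) \<and> nonrecursive P \<and> definitorial P"

definition defined_vars :: "rule set \<Rightarrow> var set" where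
  "defined_vars P = (\<Union>r\<in>P. head_vars r)"

definition program_vars :: "rule set \<Rightarrow> var set" where
  "program_vars P = (\<Union>r\<in>P. head_vars r \<union> body_vars r)"

definition input_vars :: "rule set \<Rightarrow> var set" where
  "input_vars P = program_vars P - defined_vars P"

lemma eval_formula_cong [fundef_cong]:
  assumes "\<alpha> = \<beta>" and "\<And>a. a \<in> formula_vars \<beta> \<Longrightarrow> v a = w a"
  shows "eval_formula v \<alpha> = eval_formula w \<beta>"
  using assms(2) unfolding assms(1) by (induction \<beta>) auto

lemma finite_formula_vars: "finite (formula_vars \<alpha>)"
  by (induction \<alpha>) auto

lemma finite_dependency:
  assumes "finite P"
  shows "finite (dependency P)"
proof -
  have "finite (body_vars r \<times> head_vars r)" for r
    by (cases r) (auto simp: finite_formula_vars)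
  moreover have "dependency P = (\<Union>r\<in>P. body_vars r \<times> head_vars r)"
    unfolding dependency_def by auto
  ultimately show ?thesis
    using assms by simp
qed

text \<open>\<open>sat_var P I t p\<close> is satisfaction of the variable \<open>p\<close> at time \<open>t\<close>, where
  \<open>I\<close> lists \<open>I\<^sub>1, \<dots>, I\<^sub>\<ell>\<close>. There is no \<open>I\<^sub>0\<close>, so input variables are false at time 0;
  there is no time before 0, so delayed variables are false at time 0.
  The outermost guard makes the recursion terminate and holds for every program.
  States are numbered from 1, list positions from 0: the state \<open>i\<close> belongs to \<open>ps ! (i - 1)\<close>.\<close>

context
  notes conj_cong [fundef_cong]
begin

function sat_var :: "rule set \<Rightarrow> var set list \<Rightarrow> nat \<Rightarrow> var \<Rightarrow> bool" where
  "sat_var P I t p \<longleftrightarrow> finite P \<and> nonrecursive P \<and>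
     (p \<notin> defined_vars P \<and> t \<in> {1..length I} \<and> p \<in> I ! (t - 1) \<or>
      (\<exists>\<alpha>. Static p \<alpha> \<in> P \<and> eval_formula (\<lambda>q. sat_var P I t q) \<alpha>) \<or>
      (\<exists>q. Delay p q \<in> P \<and> t > 0 \<and> sat_var P I (t - 1) q) \<or>
      (\<exists>ps A as i. Dynamic ps A as \<in> P \<and> i \<in> {1..length ps} \<and> ps ! (i - 1) = p \<and>
         (if t = 0 then op_init A = i
          else \<exists>j \<sigma>. j \<in> {1..op_out A} \<and> \<sigma> \<in> bvecs (op_in A) \<and> op_delta A j \<sigma> = i \<and>
                 sat_var P I (t - 1) (ps ! (j - 1)) \<and>
                 (\<forall>k\<in>{..<length as}. sat_var P I t (as ! k) \<longleftrightarrow> \<sigma> ! k))))"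
  by pat_completeness auto

termination
proof (relation "same_fst (\<lambda>P. finite P \<and> nonrecursive P)
    (\<lambda>P. same_fst (\<lambda>I. True) (\<lambda>I. less_than <*lex*> dependency P))", goal_cases)
  case 1
  show ?case
    by (intro wf_same_fst wf_lex_prod wf_less_than finite_acyclic_wf finite_dependency)
       (auto simp: nonrecursive_def)
next
  case (2 P I t p \<alpha> q)
  then show ?case by (force simp: dependency_def same_fst_def)
next
  case (3 P I t p q)
  then show ?case by (simp add: same_fst_def)
next
  case (4 P I t p ps A as i j \<sigma>)
  then show ?case by (simp add: same_fst_def)
next
  case (5 P I t p ps A as i j \<sigma> k)
  then have "as ! k \<in> set as" "p \<in> set ps" "Dynamic ps A as \<in> P"
    by (auto intro!: nth_mem)
  then have "(as ! k, p) \<in> dependency P"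
    unfolding dependency_def by force
  with 5 show ?case by (simp add: same_fst_def)
qed

end

declare sat_var.simps [simp del]

definition KR_logic :: "operator_automaton set \<Rightarrow> rule set set" where
  "KR_logic \<A> = {P. is_program P \<and> (\<forall>ps A as. Dynamic ps A as \<in> P \<longrightarrow> A \<in> \<A>)}"

definition letter_assignment :: "var list \<Rightarrow> bool list \<Rightarrow> var set" where
  "letter_assignment xs \<sigma> = {xs ! k | k. k < length xs \<and> \<sigma> ! k}"

definition recognised_language :: "rule set \<Rightarrow> var list \<Rightarrow> var \<Rightarrow> bool list list set" where
  "recognised_language P xs a =
     {w \<in> lists (bvecs (length xs)).
        w \<noteq> [] \<and> sat_var P (map (letter_assignment xs) w) (length w) a}"

text \<open>A language over \<open>\<bool>\<^sup>m\<close> is represented together with \<open>m\<close>.\<close>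

definition expressivity :: "rule set set \<Rightarrow> (nat \<times> bool list list set) set" where
  "expressivity \<L> =
     {(length xs, recognised_language P xs a) | P xs a.
        P \<in> \<L> \<and> distinct xs \<and> set xs = input_vars P \<and> a \<in> program_vars P}"

text \<open>Regularity is acceptance by a finite automaton; since the state set is finite,
  natural numbers suffice as states.\<close>

definition regular_language :: "'s set \<Rightarrow> 's list set \<Rightarrow> bool" where
  "regular_language \<Sigma> L \<longleftrightarrow>
     (\<exists>(D :: ('s, nat) semiautomaton) q0 F.
        is_semiautomaton D \<and> alphabet D = \<Sigma> \<and> finite (states D) \<and>
        q0 \<in> states D \<and> F \<subseteq> states D \<and>
        L = {w \<in> lists \<Sigma>. foldl (trans_fun D) q0 w \<in> F})"

end

theory Submission imports Defs "HOL-Algebra.Weak_Morphisms" begin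

text \<open>The valuation of the variables after reading a word is determined by the previous valuation
  and the last letter, and there are finitely many valuations; so recognised languages are regular.

  Conversely, call a function from words to truth values a signal if it is obtained from the inputs
  by Boolean operations, delays and runs of prime operators; every signal is computed by a variable
  of some program. A regular language is decided by the running product of the
  transformations that the letters induce on the states of an automaton, so it remains to show that
  running products in a finite monoid are made of signals (the Krohn--Rhodes theorem). A monoid
  generated by units is a group, where one descends along a normal subgroup until the group is
  simple. For a generator \<open>c\<close> that is not a unit, one cuts words at the occurrences of \<open>c\<close> and
  multiplies the factors in the local divisor \<open>c M \<inter> M c\<close>, which is smaller than \<open>M\<close>, following
  the proof by Diekert, Kufleitner and Steinberg.\<close>

section \<open>Recognised languages are regular\<close>

text \<open>The values of \<open>f\<close> serve as states: by \<open>step\<close>, the value at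
  \<open>w @ [a]\<close> is fixed by \<open>a\<close> and the value at \<open>w\<close>.\<close>

lemma regular_language_if_right_congruence:
  fixes f :: "'s list \<Rightarrow> 'b"
  assumes fin: "finite (f ` lists \<Sigma>)"
    and step: "\<And>w w' a. w \<in> lists \<Sigma> \<Longrightarrow> w' \<in> lists \<Sigma> \<Longrightarrow> a \<in> \<Sigma> \<Longrightarrow> f w = f w' \<Longrightarrow>
      f (w @ [a]) = f (w' @ [a])"
  shows "regular_language \<Sigma> {w \<in> lists \<Sigma>. f w \<in> T}"
proof -
  obtain g :: "'b \<Rightarrow> nat" where g: "inj_on g (f ` lists \<Sigma>)"
    using finite_imp_inj_to_nat_seg[OF fin] by blast
  \<comment> \<open>\<open>r\<close> picks a word reaching the given state, and a transition appends
    the letter to that word; by \<open>step\<close> the result is the same for every choice.\<close>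
  define r where "r q = (SOME w. w \<in> lists \<Sigma> \<and> g (f w) = q)" for q
  define D where "D = \<lparr>alphabet = \<Sigma>, states = g ` f ` lists \<Sigma>,
    trans_fun = (\<lambda>q a. g (f (r q @ [a])))\<rparr>"
  have r: "r (g (f w)) \<in> lists \<Sigma> \<and> f (r (g (f w))) = f w" if "w \<in> lists \<Sigma>" for w
  proof -
    have "r (g (f w)) \<in> lists \<Sigma> \<and> g (f (r (g (f w)))) = g (f w)"
      unfolding r_def by (rule someI) (use that in blast)
    then show ?thesis using g that by (meson inj_onD imageI)
  qed
  have run: "foldl (trans_fun D) (g (f [])) w = g (f w)" if "w \<in> lists \<Sigma>" for w
    using that
  proof (induction w rule: rev_induct)
    case (snoc a w)
    then have "w \<in> lists \<Sigma>" "a \<in> \<Sigma>" by auto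
    with snoc r[of w] step[of "r (g (f w))" w a] show ?case by (simp add: D_def)
  qed simp
  have "is_semiautomaton D"
    unfolding is_semiautomaton_def D_def using r by fastforce
  moreover have "finite (states D)" "g (f []) \<in> states D"
    using fin by (auto simp: D_def)
  moreover have "{w \<in> lists \<Sigma>. f w \<in> T} =
      {w \<in> lists \<Sigma>. foldl (trans_fun D) (g (f [])) w \<in> g ` (T \<inter> f ` lists \<Sigma>)}"
  proof -
    \<comment> \<open>The coding \<open>g\<close> is injective only on the values that
      \<open>f\<close> takes on words over \<Sigma>, hence the intersection with them.\<close>
    have "g (f w) \<in> g ` (T \<inter> f ` lists \<Sigma>) \<longleftrightarrow> f w \<in> T" if "w \<in> lists \<Sigma>" for w
      using inj_on_image_mem_iff[OF g, of "f w" "T \<inter> f ` lists \<Sigma>"] that by blast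
    then show ?thesis using run by (intro Collect_cong conj_cong refl) (simp only:)
  qed
  ultimately show ?thesis
    unfolding regular_language_def
    by (intro exI[of _ D] exI[of _ "g (f [])"] exI[of _ "g ` (T \<inter> f ` lists \<Sigma>)"])
       (auto simp: D_def)
qed

section \<open>Satisfaction of variables, by the rule that defines them\<close>

lemma program_rule_unique:
  assumes "is_program P" "r \<in> P" "r' \<in> P" "p \<in> head_vars r" "p \<in> head_vars r'"
  shows "r' = r"
  using assms unfolding is_program_def definitorial_def by blast

lemma sat_input:
  assumes "is_program P" "p \<notin> defined_vars P"
  shows "sat_var P I t p \<longleftrightarrow> t \<in> {1..length I} \<and> p \<in> I ! (t - 1)"
proof -
  have "Static p \<alpha> \<notin> P" "Delay p q \<notin> P" for \<alpha> q
    using assms(2) unfolding defined_vars_def by force+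
  moreover have "ps ! (i - 1) \<noteq> p" if "Dynamic ps A as \<in> P" "i \<in> {1..length ps}" for ps A as i
    using assms(2) that nth_mem[of "i - 1" ps] unfolding defined_vars_def by force
  ultimately show ?thesis
    using assms unfolding is_program_def by (subst sat_var.simps) blast
qed

lemma sat_static:
  assumes P: "is_program P" and r: "Static p \<alpha> \<in> P"
  shows "sat_var P I t p \<longleftrightarrow> eval_formula (sat_var P I t) \<alpha>"
proof -
  have u: "r' = Static p \<alpha>" if "r' \<in> P" "p \<in> head_vars r'" for r'
    using program_rule_unique[OF P r that(1)] that(2) by simp
  have "p \<in> defined_vars P" using r unfolding defined_vars_def by force
  moreover have "\<beta> = \<alpha>" if "Static p \<beta> \<in> P" for \<beta> using u[OF that] by simp
  moreover have "Delay p q \<notin> P" for q using u[of "Delay p q"] by auto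
  moreover have "ps ! (i - 1) \<noteq> p" if "Dynamic ps A as \<in> P" "i \<in> {1..length ps}" for ps A as i
    using u[OF that(1)] that(2) nth_mem[of "i - 1" ps] by force
  ultimately show ?thesis
    using P r unfolding is_program_def by (subst sat_var.simps) blast
qed

lemma sat_delay:
  assumes P: "is_program P" and r: "Delay p q \<in> P"
  shows "sat_var P I t p \<longleftrightarrow> t > 0 \<and> sat_var P I (t - 1) q"
proof -
  have u: "r' = Delay p q" if "r' \<in> P" "p \<in> head_vars r'" for r'
    using program_rule_unique[OF P r that(1)] that(2) by simp
  have "p \<in> defined_vars P" using r unfolding defined_vars_def by force
  moreover have "q' = q" if "Delay p q' \<in> P" for q' using u[OF that] by simp
  moreover have "Static p \<alpha> \<notin> P" for \<alpha> using u[of "Static p \<alpha>"] by auto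
  moreover have "ps ! (i - 1) \<noteq> p" if "Dynamic ps A as \<in> P" "i \<in> {1..length ps}" for ps A as i
    using u[OF that(1)] that(2) nth_mem[of "i - 1" ps] by force
  ultimately show ?thesis
    using P r unfolding is_program_def by (subst sat_var.simps) blast
qed

text \<open>The variable determines its rule and, as heads are distinct, its index. The assignment
  in the defining equation can only be the one listing the current values of the arguments.\<close>

lemma sat_dynamic:
  assumes P: "is_program P" and r: "Dynamic ps A as \<in> P" and i: "i \<in> {1..length ps}"
  shows "sat_var P I t (ps ! (i - 1)) \<longleftrightarrow>
    (if t = 0 then op_init A = i
     else \<exists>j\<in>{1..op_out A}. op_delta A j (map (sat_var P I t) as) = i \<and>
       sat_var P I (t - 1) (ps ! (j - 1)))"
proof -
  let ?p = "ps ! (i - 1)"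
  have d: "distinct ps" "length as = op_in A" "finite P" "nonrecursive P"
    using P r by (auto simp: is_program_def)
  have h: "?p \<in> set ps" using i by (auto intro!: nth_mem)
  have u: "r' = Dynamic ps A as" if "r' \<in> P" "?p \<in> head_vars r'" for r'
    using program_rule_unique[OF P r that(1)] that(2) h by simp
  have nd: "?p \<in> defined_vars P" using r h unfolding defined_vars_def by force
  have nq: "Delay ?p q \<notin> P" for q using u[of "Delay ?p q"] by auto
  have ns: "Static ?p \<alpha> \<notin> P" for \<alpha> using u[of "Static ?p \<alpha>"] by auto
  have uniq: "ps' = ps \<and> A' = A \<and> as' = as \<and> i' = i"
    if "Dynamic ps' A' as' \<in> P" "i' \<in> {1..length ps'}" "ps' ! (i' - 1) = ?p" for ps' A' as' i'
  proof -
    have "?p \<in> set ps'" using that nth_mem[of "i' - 1" ps'] by force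
    then have e: "ps' = ps \<and> A' = A \<and> as' = as" using u[OF that(1)] by simp
    then have "i' - 1 = i - 1"
      using that(2,3) i d(1) by (auto simp: nth_eq_iff_index_eq)
    then show ?thesis using e that(2) i by auto
  qed
  \<comment> \<open>\<open>X\<close> abbreviates the semantics of one dynamic rule, so that
    uniqueness of rule and index applies before the inner quantifiers are opened.\<close>
  define X where "X ps (A :: operator_automaton) as i \<longleftrightarrow> (if t = 0 then op_init A = i
      else \<exists>j \<sigma>. j \<in> {1..op_out A} \<and> \<sigma> \<in> bvecs (op_in A) \<and> op_delta A j \<sigma> = i \<and>
        sat_var P I (t - 1) (ps ! (j - 1)) \<and>
        (\<forall>k\<in>{..<length as}. sat_var P I t (as ! k) \<longleftrightarrow> \<sigma> ! k))" for ps A as i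
  have "sat_var P I t ?p \<longleftrightarrow> (\<exists>ps' A' as' i'. Dynamic ps' A' as' \<in> P \<and> i' \<in> {1..length ps'} \<and>
      ps' ! (i' - 1) = ?p \<and> X ps' A' as' i')"
    unfolding X_def by (subst sat_var.simps) (simp only: d(3,4) nd nq ns simp_thms)
  also have "\<dots> \<longleftrightarrow> X ps A as i"
  proof
    assume "\<exists>ps' A' as' i'. Dynamic ps' A' as' \<in> P \<and> i' \<in> {1..length ps'} \<and>
      ps' ! (i' - 1) = ?p \<and> X ps' A' as' i'"
    then obtain ps' A' as' i' where *: "Dynamic ps' A' as' \<in> P" "i' \<in> {1..length ps'}"
      "ps' ! (i' - 1) = ?p" "X ps' A' as' i'" by blast
    show "X ps A as i" using uniq[OF *(1-3)] *(4) by simp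
  qed (use r i in blast)
  finally have sat: "sat_var P I t ?p \<longleftrightarrow> X ps A as i" .
  have word: "\<sigma> \<in> bvecs (op_in A) \<and> (\<forall>k\<in>{..<length as}. sat_var P I t (as ! k) = \<sigma> ! k) \<longleftrightarrow>
      \<sigma> = map (sat_var P I t) as" for \<sigma>
    unfolding bvecs_def list_eq_iff_nth_eq[of \<sigma>] using d(2) by auto
  have "(\<exists>\<sigma>. j \<in> {1..op_out A} \<and> \<sigma> \<in> bvecs (op_in A) \<and> op_delta A j \<sigma> = i \<and>
        sat_var P I (t - 1) (ps ! (j - 1)) \<and>
        (\<forall>k\<in>{..<length as}. sat_var P I t (as ! k) \<longleftrightarrow> \<sigma> ! k)) \<longleftrightarrow>
      j \<in> {1..op_out A} \<and> op_delta A j (map (sat_var P I t) as) = i \<and>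
        sat_var P I (t - 1) (ps ! (j - 1))" for j
    using word by (intro iffI) (elim exE conjE, metis, metis)
  then show ?thesis unfolding sat X_def Bex_def by (simp only:)
qed

lemma defined_var_cases:
  assumes "p \<in> defined_vars P"
  obtains (static) \<alpha> where "Static p \<alpha> \<in> P"
  | (delay) q where "Delay p q \<in> P"
  | (dynamic) ps A as i where "Dynamic ps A as \<in> P" "i \<in> {1..length ps}" "p = ps ! (i - 1)"
proof -
  obtain r where r: "r \<in> P" "p \<in> head_vars r" using assms by (auto simp: defined_vars_def)
  show thesis
  proof (cases r)
    case (Dynamic ps A as)
    with r obtain k where "k < length ps" "p = ps ! k" by (auto simp: in_set_conv_nth)
    then show thesis using Dynamic r dynamic[of ps A as "Suc k"] by auto
  qed (use r static delay in auto)
qed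

lemma wf_dependency:
  assumes "is_program P"
  shows "wf (dependency P)"
  using assms by (auto simp: is_program_def nonrecursive_def intro!: finite_acyclic_wf finite_dependency)

lemma body_in_program_vars: "r \<in> P \<Longrightarrow> x \<in> body_vars r \<Longrightarrow> x \<in> program_vars P"
  and head_in_program_vars: "r \<in> P \<Longrightarrow> x \<in> head_vars r \<Longrightarrow> x \<in> program_vars P"
  by (auto simp: program_vars_def)

lemma finite_program_vars:
  assumes "finite P"
  shows "finite (program_vars P)"
proof -
  have "finite (head_vars r \<union> body_vars r)" for r
    by (cases r) (auto simp: finite_formula_vars)
  then show ?thesis using assms by (simp add: program_vars_def)
qed

text \<open>The two programs need not coincide: this covers both the finite-state argument
  (one program, two inputs) and conservativity of program extensions (one input).\<close>

lemma sat_transfer: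
  assumes P: "is_program P" and P': "is_program P'" and sub: "P \<subseteq> P'"
    and inp: "\<And>p. p \<in> program_vars P \<Longrightarrow> p \<notin> defined_vars P \<Longrightarrow> p \<notin> defined_vars P'"
    and times: "t = 0 \<and> t' = 0 \<or> t \<in> {1..length I} \<and> t' \<in> {1..length I'} \<and> I ! (t - 1) = I' ! (t' - 1) \<or>
      t > length I \<and> t' > length I'"
    and prev: "\<And>p. t > 0 \<Longrightarrow> p \<in> program_vars P \<Longrightarrow>
      sat_var P I (t - 1) p = sat_var P' I' (t' - 1) p"
  assumes "p \<in> program_vars P"
  shows "sat_var P I t p = sat_var P' I' t' p"
  using wf_dependency[OF P] assms(7)
\<comment> \<open>At one time point, values depend on each other only along
  \<open>dependency\<close>. The previous time, which delays and the states of dynamic rules refer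
  to, is covered by \<open>prev\<close>.\<close>
proof (induction p rule: wf_induct_rule)
  case (less p)
  have zero: "t = 0 \<longleftrightarrow> t' = 0" using times by auto
  have IH: "sat_var P I t q = sat_var P' I' t' q" if "r \<in> P" "q \<in> body_vars r" "p \<in> head_vars r" for r q
    using that less.IH[of q] body_in_program_vars by (auto simp: dependency_def)
  show ?case
  proof (cases "p \<in> defined_vars P")
    case False
    then have "p \<notin> defined_vars P'" using inp less.prems by blast
    then show ?thesis using False times by (auto simp: sat_input[OF P] sat_input[OF P'])
  next
    case True
    then show ?thesis
    proof (cases rule: defined_var_cases)
      case (static \<alpha>)
      then have "eval_formula (sat_var P I t) \<alpha> = eval_formula (sat_var P' I' t') \<alpha>"
        using IH[OF static] by (intro eval_formula_cong) auto
      then show ?thesis using static sub sat_static[OF P] sat_static[OF P'] by blast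
    next
      case (delay q)
      then have "q \<in> program_vars P" using body_in_program_vars by force
      then show ?thesis using delay sub prev zero sat_delay[OF P] sat_delay[OF P'] by blast
    next
      case (dynamic ps A as i)
      have D': "Dynamic ps A as \<in> P'" using dynamic sub by auto
      have "p \<in> set ps" using dynamic by (auto intro!: nth_mem)
      then have as: "map (sat_var P I t) as = map (sat_var P' I' t') as"
        using IH[OF dynamic(1)] by simp
      have "op_out A = length ps" using P dynamic(1) by (auto simp: is_program_def)
      moreover have "sat_var P I (t - 1) (ps ! (j - 1)) = sat_var P' I' (t' - 1) (ps ! (j - 1))"
        if "j \<in> {1..length ps}" "t > 0" for j
        using that prev head_in_program_vars[OF dynamic(1), of "ps ! (j - 1)"]
        by (auto intro!: nth_mem)
      ultimately show ?thesis
        unfolding dynamic(3) sat_dynamic[OF P dynamic(1,2)] sat_dynamic[OF P' D' dynamic(2)] as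
        using zero by auto
    qed
  qed
qed

text \<open>Satisfaction is causal: at time \<open>t\<close> only the first \<open>t\<close> letters
  matter. This relates the valuation after \<open>w\<close> to the run on
  \<open>w @ [x]\<close>.\<close>

lemma sat_append:
  assumes "is_program P" "p \<in> program_vars P" "t \<le> length I"
  shows "sat_var P (I @ J) t p = sat_var P I t p"
  using assms(2,3)
proof (induction t arbitrary: p)
  case 0
  show ?case by (rule sat_transfer[OF assms(1) assms(1) subset_refl]) (use 0 in simp_all)
next
  case (Suc t)
  show ?case
    by (rule sat_transfer[OF assms(1) assms(1) subset_refl])
       (use Suc in \<open>simp_all add: nth_append\<close>)
qed

lemma recognised_language_regular:
  assumes P: "is_program P" and a: "a \<in> program_vars P"
  shows "regular_language (bvecs (length xs)) (recognised_language P xs a)"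
proof -
  let ?I = "map (letter_assignment xs)"
  \<comment> \<open>The state is the valuation at the last time. The Boolean singles out the empty
    word, which is never recognised even if \<open>a\<close> holds at time 0.\<close>
  define f where "f w = (w = [], {p \<in> program_vars P. sat_var P (?I w) (length w) p})" for w
  have "f ` lists (bvecs (length xs)) \<subseteq> UNIV \<times> Pow (program_vars P)"
    by (auto simp: f_def)
  then have fin: "finite (f ` lists (bvecs (length xs)))"
    by (rule finite_subset) (use P finite_program_vars in \<open>auto simp: is_program_def\<close>)
  have step: "f (w @ [x]) = f (w' @ [x])" if "f w = f w'" for w w' x
  proof -
    have same: "sat_var P (?I w) (length w) p = sat_var P (?I w') (length w') p"
      if "p \<in> program_vars P" for p
      using that \<open>f w = f w'\<close> by (auto simp: f_def)
    have "sat_var P (?I (w @ [x])) (length (w @ [x])) p = sat_var P (?I (w' @ [x])) (length (w' @ [x])) p"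
      if "p \<in> program_vars P" for p
      by (rule sat_transfer[OF P P subset_refl])
         (use that same in \<open>simp_all add: nth_append sat_append[OF P]\<close>)
    then show ?thesis by (auto simp: f_def)
  qed
  have "regular_language (bvecs (length xs))
      {w \<in> lists (bvecs (length xs)). f w \<in> {(False, S) | S. a \<in> S}}"
    by (rule regular_language_if_right_congruence[OF fin step])
  moreover have "{w \<in> lists (bvecs (length xs)). f w \<in> {(False, S) | S. a \<in> S}} =
      recognised_language P xs a"
    using a by (auto simp: f_def recognised_language_def)
  ultimately show ?thesis by simp
qed

section \<open>Signals and the programs that compute them\<close>

text \<open>\<open>F\<close> receives the whole prefix read so far instead of its last letter, so
  the automaton can be driven by inputs that were themselves computed from the history.\<close>

definition run :: "('q \<Rightarrow> 'b \<Rightarrow> 'q) \<Rightarrow> ('s list \<Rightarrow> 'b) \<Rightarrow> 'q \<Rightarrow> 's list \<Rightarrow> 'q" where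
  "run \<delta> F q w = foldl (\<lambda>q k. \<delta> q (F (take (Suc k) w))) q [0..<length w]"

lemma run_Nil [simp]: "run \<delta> F q [] = q"
  by (simp add: run_def)

lemma run_snoc [simp]: "run \<delta> F q (w @ [a]) = \<delta> (run \<delta> F q w) (F (w @ [a]))"
proof -
  have "foldl (\<lambda>q k. \<delta> q (F (take (Suc k) (w @ [a])))) q [0..<n] =
      foldl (\<lambda>q k. \<delta> q (F (take (Suc k) w))) q [0..<n]" if "n \<le> length w" for n
    using that by (induction n) auto
  then show ?thesis by (simp add: run_def)
qed

lemma run_unique:
  assumes "S [] = q" "\<And>w a. S (w @ [a]) = \<delta> (S w) (F (w @ [a]))"
  shows "S w = run \<delta> F q w"
  by (induction w rule: rev_induct) (simp_all add: assms)

lemma run_in: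
  assumes "q \<in> S" "\<And>q w. q \<in> S \<Longrightarrow> \<delta> q (F w) \<in> S"
  shows "run \<delta> F q w \<in> S"
  by (induction w rule: rev_induct) (simp_all add: assms)

text \<open>The value of a signal at a word is the truth value of a program variable after reading
  that word, the empty word standing for time 0.\<close>

inductive_set signals :: "nat \<Rightarrow> (bool list list \<Rightarrow> bool) set" for m where
  input: "i < m \<Longrightarrow> (\<lambda>w. w \<noteq> [] \<and> last w ! i) \<in> signals m"
| top: "(\<lambda>w. True) \<in> signals m"
| neg: "f \<in> signals m \<Longrightarrow> (\<lambda>w. \<not> f w) \<in> signals m"
| conj: "f \<in> signals m \<Longrightarrow> g \<in> signals m \<Longrightarrow> (\<lambda>w. f w \<and> g w) \<in> signals m"
| delay: "f \<in> signals m \<Longrightarrow> (\<lambda>w. w \<noteq> [] \<and> f (butlast w)) \<in> signals m"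
| dynamic: "prime_operator A \<Longrightarrow> length fs = op_in A \<Longrightarrow> \<forall>f\<in>set fs. f \<in> signals m \<Longrightarrow>
    i \<in> {1..op_out A} \<Longrightarrow> (\<lambda>w. run (op_delta A) (\<lambda>w. map (\<lambda>f. f w) fs) (op_init A) w = i) \<in> signals m"

definition good_program :: "nat \<Rightarrow> rule set \<Rightarrow> bool" where
  "good_program m P \<longleftrightarrow> P \<in> KR_logic {A. prime_operator A} \<and> input_vars P = {..<m}"

text \<open>All times up to the length of \<open>w\<close> are included because delays and dynamic
  rules look back at earlier ones.\<close>

definition represents :: "nat \<Rightarrow> rule set \<Rightarrow> var \<Rightarrow> (bool list list \<Rightarrow> bool) \<Rightarrow> bool" where
  "represents m P p f \<longleftrightarrow> p \<in> program_vars P \<and>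
     (\<forall>w t. t \<le> length w \<longrightarrow>
        sat_var P (map (letter_assignment [0..<m]) w) t p = f (take t w))"

lemma wf_Times:
  assumes "X \<inter> Y = {}"
  shows "wf (X \<times> Y)"
  using assms unfolding wf_def by blast

lemma good_programD:
  assumes "good_program m P"
  shows "is_program P" "finite (program_vars P)"
  using assms finite_program_vars by (auto simp: good_program_def KR_logic_def is_program_def)

text \<open>The heads of the new rule are fresh and its body is old, so no cycle can close, and by
  \<open>sat_transfer\<close> the old variables keep their values.\<close>

lemma good_program_insert:
  assumes P: "good_program m P"
    and wf: "wf_rule r" and prime: "\<forall>ps A as. r = Dynamic ps A as \<longrightarrow> prime_operator A"
    and body: "body_vars r \<subseteq> program_vars P" and head: "head_vars r \<inter> program_vars P = {}"
  shows "good_program m (insert r P)"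
    and "represents m P p f \<Longrightarrow> represents m (insert r P) p f"
proof -
  have isP: "is_program P" using P good_programD by blast
  let ?D = "body_vars r \<times> head_vars r"
  have dep: "dependency (insert r P) = dependency P \<union> ?D"
    by (auto simp: dependency_def)
  have "wf ?D"
    by (rule wf_Times) (use body head in auto)
  \<comment> \<open>No old edge starts at a fresh variable; this is the side condition under which a
    union of two well-founded relations is well-founded.\<close>
  moreover have "Domain (dependency P) \<inter> Range ?D = {}"
    using head body_in_program_vars[of _ P] by (auto simp: dependency_def)
  ultimately have "wf (dependency P \<union> ?D)"
    using wf_dependency[OF isP] by (intro wf_Un) auto
  then have "nonrecursive (insert r P)" unfolding nonrecursive_def dep by (rule wf_acyclic)
  moreover have "definitorial (insert r P)"
    using isP head head_in_program_vars[of _ P] unfolding is_program_def definitorial_def by blast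
  ultimately have P': "is_program (insert r P)"
    using isP wf by (auto simp: is_program_def)
  moreover have "program_vars (insert r P) = program_vars P \<union> head_vars r"
    using body by (auto simp: program_vars_def)
  moreover have def: "defined_vars (insert r P) = defined_vars P \<union> head_vars r"
    by (auto simp: defined_vars_def)
  ultimately show "good_program m (insert r P)"
    using P prime head by (auto simp: good_program_def KR_logic_def input_vars_def) blast
  have same: "sat_var (insert r P) I t p = sat_var P I t p" if "p \<in> program_vars P" for I t p
    using that
  proof (induction t arbitrary: p)
    case 0
    show ?case
      by (rule sat_transfer[OF isP P', symmetric]) (use 0 def head in auto)
  next
    case (Suc t)
    show ?case
      by (rule sat_transfer[OF isP P', symmetric]) (use Suc def head in auto)
  qed
  show "represents m (insert r P) p f" if "represents m P p f"
    using that same by (auto simp: represents_def program_vars_def)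
qed

lemma fresh_vars:
  assumes "finite (V :: var set)"
  obtains k where "\<And>n. k \<le> n \<Longrightarrow> n \<notin> V"
  using assms by (metis finite_nat_set_iff_bounded leD)

text \<open>An input variable must occur in some rule, so one static rule mentions all numbers below
  \<open>m\<close> in its body.\<close>

lemma good_program_exists: "\<exists>P. good_program m P"
proof -
  define \<alpha> where "\<alpha> = foldr (\<lambda>i. Conj (Var i)) [0..<m] Top"
  have \<alpha>: "formula_vars \<alpha> = {..<m}"
  proof -
    have "formula_vars (foldr (\<lambda>i. Conj (Var i)) is Top) = set is" for "is"
      by (induction "is") auto
    then show ?thesis by (auto simp: \<alpha>_def)
  qed
  let ?P = "{Static m \<alpha>}"
  have "nonrecursive ?P"
  proof -
    have "dependency ?P = {..<m} \<times> {m}" by (auto simp: dependency_def \<alpha>)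
    then show ?thesis unfolding nonrecursive_def by (simp add: wf_acyclic wf_Times)
  qed
  then have "is_program ?P" by (simp add: is_program_def definitorial_def)
  then have "good_program m ?P"
    by (auto simp: good_program_def KR_logic_def input_vars_def program_vars_def defined_vars_def \<alpha>)
  then show ?thesis by blast
qed

lemma represent_insert:
  assumes "good_program m P" "wf_rule r" "\<forall>ps A as. r = Dynamic ps A as \<longrightarrow> prime_operator A"
    "body_vars r \<subseteq> program_vars P" "head_vars r \<inter> program_vars P = {}"
    "p \<in> head_vars r"
    "\<And>w t. is_program (insert r P) \<Longrightarrow> t \<le> length w \<Longrightarrow>
      sat_var (insert r P) (map (letter_assignment [0..<m]) w) t p = f (take t w)"
  shows "\<exists>P' p. good_program m P' \<and> represents m P' p f \<and>
    (\<forall>q g. represents m P q g \<longrightarrow> represents m P' q g)"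
proof -
  have g: "good_program m (insert r P)"
    by (rule good_program_insert(1)[OF assms(1-5)])
  have "represents m (insert r P) p f"
    unfolding represents_def using assms(6,7) good_programD(1)[OF g]
    by (auto simp: program_vars_def)
  moreover have "represents m (insert r P) q g'" if "represents m P q g'" for q g'
    by (rule good_program_insert(2)[OF assms(1-5) that])
  ultimately show ?thesis using g by blast
qed

text \<open>The last conjunct preserves what was represented before, so that the arguments of a
  connective or an operator can be added to one program one after another.\<close>

lemma representable:
  assumes "f \<in> signals m" "good_program m P"
  shows "\<exists>P' p. good_program m P' \<and> represents m P' p f \<and>
    (\<forall>q g. represents m P q g \<longrightarrow> represents m P' q g)"
  using assms
proof (induction arbitrary: P)
  case (input i)
  then have ip: "i \<in> program_vars P" "i \<notin> defined_vars P"
    by (auto simp: good_program_def input_vars_def)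
  have "represents m P i (\<lambda>w. w \<noteq> [] \<and> last w ! i)"
    unfolding represents_def
  proof (intro conjI allI impI ip)
    fix w :: "bool list list" and t assume t: "t \<le> length w"
    have "last (take t w) = w ! (t - 1)" if "t > 0"
      using that t by (cases t) (auto simp: take_Suc_conv_app_nth)
    then show "sat_var P (map (letter_assignment [0..<m]) w) t i =
        (take t w \<noteq> [] \<and> last (take t w) ! i)"
      using sat_input[OF good_programD(1)[OF input(2)] ip(2)] t input(1)
      by (cases t) (auto simp: letter_assignment_def intro: exI[of _ i])
  qed
  with input show ?case by blast
next
  case top
  obtain k where k: "\<And>n. k \<le> n \<Longrightarrow> n \<notin> program_vars P"
    using fresh_vars good_programD(2)[OF top] by blast
  show ?case
    by (rule represent_insert[where r = "Static k Top" and p = k])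
       (use top k in \<open>auto simp: sat_static[of "insert (Static k Top) P" k Top]\<close>)
next
  case (neg f)
  obtain P1 p where P1: "good_program m P1" "represents m P1 p f"
    "\<And>q g. represents m P q g \<Longrightarrow> represents m P1 q g" using neg by blast
  obtain k where k: "\<And>n. k \<le> n \<Longrightarrow> n \<notin> program_vars P1"
    using fresh_vars good_programD(2)[OF P1(1)] by blast
  let ?r = "Static k (Neg (Var p))"
  have p: "p \<in> program_vars P1" using P1(2) by (simp add: represents_def)
  have "represents m (insert ?r P1) p f"
    by (rule good_program_insert(2)) (use P1(1,2) p k in auto)
  then have "\<exists>P' p. good_program m P' \<and> represents m P' p (\<lambda>w. \<not> f w) \<and>
      (\<forall>q g. represents m P1 q g \<longrightarrow> represents m P' q g)"
    by (intro represent_insert[where r = "?r" and p = k])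
       (use P1(1) p k in \<open>auto simp: sat_static[of "insert ?r P1" k "Neg (Var p)"] represents_def\<close>)
  then show ?case using P1(3) by blast
next
  case (conj f g)
  obtain P1 p where P1: "good_program m P1" "represents m P1 p f"
    "\<And>q g. represents m P q g \<Longrightarrow> represents m P1 q g" using conj.IH(1)[OF conj.prems] by blast
  obtain P2 q where P2: "good_program m P2" "represents m P2 q g"
    "\<And>q g. represents m P1 q g \<Longrightarrow> represents m P2 q g" using conj.IH(2)[OF P1(1)] by blast
  obtain k where k: "\<And>n. k \<le> n \<Longrightarrow> n \<notin> program_vars P2"
    using fresh_vars good_programD(2)[OF P2(1)] by blast
  let ?r = "Static k (Conj (Var p) (Var q))"
  have reps: "represents m P2 p f" "represents m P2 q g" using P1(2) P2(2,3) by blast+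
  then have p: "p \<in> program_vars P2" "q \<in> program_vars P2" by (simp_all add: represents_def)
  have "represents m (insert ?r P2) p f" "represents m (insert ?r P2) q g"
    using good_program_insert(2)[OF P2(1) _ _ _ _ reps(1), of ?r]
      good_program_insert(2)[OF P2(1) _ _ _ _ reps(2), of ?r] p k[of k] by simp_all
  then have "\<exists>P' p. good_program m P' \<and> represents m P' p (\<lambda>w. f w \<and> g w) \<and>
      (\<forall>q g. represents m P2 q g \<longrightarrow> represents m P' q g)"
    by (intro represent_insert[where r = "?r" and p = k])
       (use P2(1) p k in \<open>auto simp: sat_static[of "insert ?r P2" k "Conj (Var p) (Var q)"] represents_def\<close>)
  then show ?case using P1(3) P2(3) by blast
next
  case (delay f)
  obtain P1 p where P1: "good_program m P1" "represents m P1 p f"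
    "\<And>q g. represents m P q g \<Longrightarrow> represents m P1 q g" using delay by blast
  obtain k where k: "\<And>n. k \<le> n \<Longrightarrow> n \<notin> program_vars P1"
    using fresh_vars good_programD(2)[OF P1(1)] by blast
  let ?r = "Delay k p"
  have p: "p \<in> program_vars P1" using P1(2) by (simp add: represents_def)
  have "represents m (insert ?r P1) p f"
    by (rule good_program_insert(2)) (use P1(1,2) p k in auto)
  moreover have "butlast (take t w) = take (t - 1) w" if "t \<le> length w" for t and w :: "bool list list"
    using that by (simp add: butlast_take)
  ultimately have "\<exists>P' p. good_program m P' \<and> represents m P' p (\<lambda>w. w \<noteq> [] \<and> f (butlast w)) \<and>
      (\<forall>q g. represents m P1 q g \<longrightarrow> represents m P' q g)"
    by (intro represent_insert[where r = "?r" and p = k])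
       (use P1(1) p k in \<open>auto simp: sat_delay[of "insert ?r P1" k p] represents_def\<close>)
  then show ?case using P1(3) by blast
next
  case (dynamic A fs i)
  have "\<exists>P' as. good_program m P' \<and> list_all2 (represents m P') as fs' \<and>
      (\<forall>q g. represents m P q g \<longrightarrow> represents m P' q g)" if "set fs' \<subseteq> set fs" for fs'
    using that
  proof (induction fs')
    case Nil
    then show ?case using dynamic.prems by auto
  next
    case (Cons f fs')
    then obtain P1 as where P1: "good_program m P1" "list_all2 (represents m P1) as fs'"
      "\<And>q g. represents m P q g \<Longrightarrow> represents m P1 q g" by auto
    have "\<exists>P' p. good_program m P' \<and> represents m P' p f \<and>
        (\<forall>q g. represents m P1 q g \<longrightarrow> represents m P' q g)"
      using dynamic.IH Cons.prems P1(1) by auto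
    then obtain P2 p where P2: "good_program m P2" "represents m P2 p f"
      "\<And>q g. represents m P1 q g \<Longrightarrow> represents m P2 q g" by blast
    have "list_all2 (represents m P2) (p # as) (f # fs')"
      using P1(2) P2(2,3) by (auto elim: list_all2_mono)
    then show ?case using P1(3) P2(1,3) by blast
  qed
  then obtain P1 as where P1: "good_program m P1" "list_all2 (represents m P1) as fs"
    "\<And>q g. represents m P q g \<Longrightarrow> represents m P1 q g" by blast
  obtain k where k: "\<And>n. k \<le> n \<Longrightarrow> n \<notin> program_vars P1"
    using fresh_vars good_programD(2)[OF P1(1)] by blast
  define ps where "ps = [k..<k + op_out A]"
  let ?r = "Dynamic ps A as"
  let ?P = "insert ?r P1"
  let ?f = "\<lambda>w. run (op_delta A) (\<lambda>w. map (\<lambda>f. f w) fs) (op_init A) w"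
  have A: "is_operator_automaton A" using dynamic.hyps by (auto simp: prime_operator_def)
  have as: "length as = length fs" using P1(2) by (rule list_all2_lengthD)
  have "set as \<subseteq> program_vars P1"
    using P1(2) by (auto simp: represents_def list_all2_conv_all_nth in_set_conv_nth)
  then have r: "wf_rule ?r" "body_vars ?r \<subseteq> program_vars P1" "head_vars ?r \<inter> program_vars P1 = {}"
    "\<forall>ps' A' as'. ?r = Dynamic ps' A' as' \<longrightarrow> prime_operator A'"
    using A as k dynamic.hyps by (auto simp: ps_def)
  have as': "represents m ?P (as ! j) (fs ! j)" if "j < length fs" for j
    by (rule good_program_insert(2)) (use P1(1,2) r that in \<open>auto simp: list_all2_conv_all_nth\<close>)
  have prog: "is_program ?P"
    using good_programD(1) good_program_insert(1)[OF P1(1) r(1,4,2,3)] by blast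
  \<comment> \<open>The claim covers all heads at once, since the transition into state
    \<open>i\<close> consults the heads of all states at the previous time.\<close>
  have "sat_var ?P (map (letter_assignment [0..<m]) w) t (ps ! (i - 1)) \<longleftrightarrow> ?f (take t w) = i"
    if "t \<le> length w" "i \<in> {1..op_out A}" for w t i
    using that
  proof (induction t arbitrary: i)
    case 0
    then show ?case by (subst sat_dynamic[OF prog, of ps A as]) (auto simp: ps_def)
  next
    case (Suc t)
    let ?I = "map (letter_assignment [0..<m]) w"
    have map: "map (sat_var ?P ?I (Suc t)) as = map (\<lambda>f. f (take (Suc t) w)) fs"
      using as' as Suc.prems by (auto simp: represents_def list_eq_iff_nth_eq)
    \<comment> \<open>The run stays among the states, so at each time exactly one head is true, and
      it supplies the witness \<open>j\<close> below.\<close>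
    have range: "?f (take t w) \<in> {1..op_out A}"
      using A as dynamic.hyps
      by (intro run_in) (auto simp: is_operator_automaton_def op_semiautomaton_def
          is_semiautomaton_def bvecs_def)
    have run: "?f (take (Suc t) w) =
        op_delta A (?f (take t w)) (map (\<lambda>f. f (take (Suc t) w)) fs)"
      using Suc.prems by (simp add: take_Suc_conv_app_nth)
    have IH: "sat_var ?P ?I t (ps ! (j - 1)) \<longleftrightarrow> ?f (take t w) = j" if "j \<in> {1..op_out A}" for j
      using Suc.IH[OF _ that] Suc.prems by simp
    have "sat_var ?P ?I (Suc t) (ps ! (i - 1)) \<longleftrightarrow> (\<exists>j\<in>{1..op_out A}.
        op_delta A j (map (\<lambda>f. f (take (Suc t) w)) fs) = i \<and> sat_var ?P ?I t (ps ! (j - 1)))"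
      using Suc.prems unfolding map[symmetric]
      by (subst sat_dynamic[OF prog, of ps A as]) (simp_all add: ps_def)
    then show ?case unfolding run using IH range by blast
  qed
  moreover have "ps ! (i - 1) \<in> head_vars ?r"
    using dynamic.hyps by (auto simp: ps_def)
  ultimately have "\<exists>P' p. good_program m P' \<and> represents m P' p (\<lambda>w. ?f w = i) \<and>
      (\<forall>q g. represents m P1 q g \<longrightarrow> represents m P' q g)"
    by (intro represent_insert[OF P1(1) r(1,4,2,3)]) (use dynamic.hyps in auto)
  then show ?case using P1(3) by blast
qed

lemma signal_expressible:
  assumes "f \<in> signals m"
  shows "(m, {w \<in> lists (bvecs m). w \<noteq> [] \<and> f w}) \<in> expressivity (KR_logic {A. prime_operator A})"
proof -
  obtain P p where P: "good_program m P" "represents m P p f"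
    using representable[OF assms] good_program_exists by blast
  have "recognised_language P [0..<m] p = {w \<in> lists (bvecs m). w \<noteq> [] \<and> f w}"
    using P(2) by (auto simp: recognised_language_def represents_def)
  then show ?thesis
    using P unfolding expressivity_def good_program_def represents_def
    by (intro CollectI exI[of _ P] exI[of _ "[0..<m]"] exI[of _ p]) auto
qed

section \<open>Functions with finitely many values, all of whose fibres are signals\<close>

definition computable :: "nat \<Rightarrow> (bool list list \<Rightarrow> 'a) \<Rightarrow> bool" where
  "computable m F \<longleftrightarrow> finite (range F) \<and> (\<forall>a. (\<lambda>w. F w = a) \<in> signals m)"

lemma signals_False: "(\<lambda>w. False) \<in> signals m"
  using signals.neg[OF signals.top] by simp

lemma signals_disj:
  assumes "f \<in> signals m" "g \<in> signals m"
  shows "(\<lambda>w. f w \<or> g w) \<in> signals m"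
proof -
  have "(\<lambda>w. \<not> (\<not> f w \<and> \<not> g w)) \<in> signals m"
    by (intro signals.neg signals.conj assms)
  then show ?thesis by simp
qed

lemma signals_Bex:
  assumes "finite S" "\<And>i. i \<in> S \<Longrightarrow> f i \<in> signals m"
  shows "(\<lambda>w. \<exists>i\<in>S. f i w) \<in> signals m"
  using assms by (induction S) (auto intro: signals_False signals_disj)

lemma signals_nonempty: "(\<lambda>w. w \<noteq> []) \<in> signals m"
  using signals.delay[OF signals.top] by simp

lemma computable_pred:
  assumes "computable m F"
  shows "(\<lambda>w. Q (F w)) \<in> signals m"
proof -
  have "(\<lambda>w. \<exists>a\<in>{a \<in> range F. Q a}. F w = a) \<in> signals m"
    using assms by (intro signals_Bex) (auto simp: computable_def)
  moreover have "(\<exists>a\<in>{a \<in> range F. Q a}. F w = a) \<longleftrightarrow> Q (F w)" for w by auto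
  ultimately show ?thesis by (simp only:)
qed

lemma computable_map:
  assumes "computable m F"
  shows "computable m (\<lambda>w. g (F w))"
proof -
  have "range (\<lambda>w. g (F w)) = g ` range F" by auto
  then show ?thesis
    using assms computable_pred[OF assms, of "\<lambda>x. g x = _"] by (simp add: computable_def)
qed

lemma computable_Pair:
  assumes "computable m F" "computable m G"
  shows "computable m (\<lambda>w. (F w, G w))"
proof -
  have "finite (range (\<lambda>w. (F w, G w)))"
    by (rule finite_subset[of _ "range F \<times> range G"]) (use assms in \<open>auto simp: computable_def\<close>)
  moreover have "(\<lambda>w. (F w, G w) = a) \<in> signals m" for a
    using assms by (cases a) (auto simp: computable_def intro!: signals.conj)
  ultimately show ?thesis by (simp add: computable_def)
qed

lemma computable_map2:
  assumes "computable m F" "computable m G"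
  shows "computable m (\<lambda>w. g (F w) (G w))"
  using computable_map[OF computable_Pair[OF assms], of "\<lambda>(x, y). g x y"] by simp

lemma computable_const: "computable m (\<lambda>w. a)"
proof -
  have "(\<lambda>w. a = b) \<in> signals m" for b
    by (cases "a = b") (simp_all add: signals.top signals_False)
  then show ?thesis by (simp add: computable_def)
qed

lemma computable_signal:
  assumes "f \<in> signals m"
  shows "computable m f"
proof -
  have "(\<lambda>w. f w = a) \<in> signals m" for a
    using assms signals.neg[OF assms] by (cases a) auto
  then show ?thesis by (simp add: computable_def)
qed

lemma computable_if:
  assumes "f \<in> signals m" "computable m F" "computable m G"
  shows "computable m (\<lambda>w. if f w then F w else G w)"
  using computable_map2[OF computable_signal[OF assms(1)] computable_Pair[OF assms(2,3)],
      of "\<lambda>b (x, y). if b then x else y"] by (simp cong: if_cong)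

text \<open>A delayed signal is false at time 0. The fibre over the default \<open>d\<close> must
  therefore also admit the empty word.\<close>

lemma computable_delay:
  assumes "computable m F"
  shows "computable m (\<lambda>w. if w = [] then d else F (butlast w))"
proof -
  have "finite (range (\<lambda>w. if w = [] then d else F (butlast w)))"
    by (rule finite_subset[of _ "insert d (range F)"]) (use assms in \<open>auto simp: computable_def\<close>)
  moreover have "(\<lambda>w. (if w = [] then d else F (butlast w)) = a) \<in> signals m" for a
  proof -
    have *: "(\<lambda>w. w \<noteq> [] \<and> F (butlast w) = a) \<in> signals m"
      using assms by (intro signals.delay) (simp add: computable_def)
    have "(\<lambda>w. (w \<noteq> [] \<and> F (butlast w) = a) \<or> (\<not> w \<noteq> [] \<and> d = a)) \<in> signals m"
      by (intro signals_disj signals.conj signals.neg signals_nonempty *)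
         (cases "d = a", auto simp: signals.top signals_False)
    moreover have "(w \<noteq> [] \<and> F (butlast w) = a) \<or> (\<not> w \<noteq> [] \<and> d = a) \<longleftrightarrow>
        (if w = [] then d else F (butlast w)) = a" for w by auto
    ultimately show ?thesis by (simp only:)
  qed
  ultimately show ?thesis by (simp add: computable_def)
qed

lemma computable_list:
  assumes "\<And>f. f \<in> set fs \<Longrightarrow> f \<in> signals m"
  shows "computable m (\<lambda>w. map (\<lambda>f. f w) fs)"
  using assms
proof (induction fs)
  case Nil
  show ?case by (simp add: computable_const)
next
  case (Cons f fs)
  then have "computable m f" "computable m (\<lambda>w. map (\<lambda>f. f w) fs)"
    by (auto intro: computable_signal)
  from computable_map2[OF this, of "(#)"] show ?case by simp
qed

section \<open>Runs of prime semiautomata and latches\<close>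

lemma run_cong:
  assumes "\<And>q w. \<delta> q (F w) = \<delta>' q (F' w)"
  shows "run \<delta> F q w = run \<delta>' F' q w"
  by (induction w rule: rev_induct) (simp_all add: assms)

lemma finite_bvecs: "finite (bvecs k)" and card_bvecs: "card (bvecs k) = 2 ^ k"
  using finite_lists_length_eq[of "UNIV :: bool set" k] card_lists_length_eq[of "UNIV :: bool set" k]
  by (simp_all add: bvecs_def)

text \<open>An operator reads bit vectors, so the letters of \<open>D\<close> are coded by them:
  \<open>k\<close> bits suffice for \<open>k\<close> letters, as \<open>k \<le> 2 ^ k\<close>.
  Decoding is the surjective input function.\<close>

lemma computable_prime_run:
  fixes D :: "(nat, nat) semiautomaton"
  assumes D: "prime_semiautomaton D" "states D = {1..n}" "finite (alphabet D)" and q0: "q0 \<in> {1..n}"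
    and F: "computable m F" "range F \<subseteq> alphabet D"
  shows "computable m (run (trans_fun D) F q0)"
proof -
  define k where "k = card (alphabet D)"
  have "card (alphabet D) \<le> card (bvecs k)"
    by (simp add: card_bvecs k_def less_imp_le)
  then obtain \<rho> where \<rho>: "\<rho> ` alphabet D \<subseteq> bvecs k" "inj_on \<rho> (alphabet D)"
    using inj_on_iff_card_le[OF D(3) finite_bvecs] by blast
  \<comment> \<open>Vectors that code no letter are sent to \<open>F []\<close>, which is a letter
    of \<open>D\<close>, so that \<phi> stays within the alphabet.\<close>
  define \<phi> where "\<phi> \<sigma> = (if \<sigma> \<in> \<rho> ` alphabet D then inv_into (alphabet D) \<rho> \<sigma> else F [])" for \<sigma>
  have \<phi>\<rho>: "\<phi> (\<rho> x) = x" if "x \<in> alphabet D" for x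
    using that \<rho> by (simp add: \<phi>_def)
  have \<phi>_in: "\<phi> \<sigma> \<in> alphabet D" for \<sigma>
    using F(2) by (auto simp: \<phi>_def inv_into_into)
  have \<phi>: "\<phi> ` bvecs k = alphabet D"
    using \<phi>_in \<phi>\<rho> \<rho>(1) by (auto simp: image_iff) (metis image_subset_iff)
  define A where "A = \<lparr>op_in = k, op_out = n, op_delta = (\<lambda>q \<sigma>. trans_fun D q (\<phi> \<sigma>)), op_init = q0\<rparr>"
  have semi: "trans_fun D q a \<in> {1..n}" if "q \<in> {1..n}" "a \<in> alphabet D" for q a
    using D that by (auto simp: prime_semiautomaton_def is_semiautomaton_def)
  have "is_operator_automaton A"
    using semi \<phi>_in q0
    by (auto simp: is_operator_automaton_def A_def op_semiautomaton_def is_semiautomaton_def)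
  moreover have "same_semiautomaton (op_semiautomaton A) (compose_input (bvecs (op_in A)) \<phi> D)"
    using D(2) by (simp add: same_semiautomaton_def op_semiautomaton_def compose_input_def A_def)
  ultimately have A: "prime_operator A"
    unfolding prime_operator_def using D(1) \<phi> by (auto simp: A_def)
  define fs where "fs = map (\<lambda>i w. \<rho> (F w) ! i) [0..<k]"
  have fs: "\<forall>f\<in>set fs. f \<in> signals m"
    using computable_pred[OF F(1), of "\<lambda>x. \<rho> x ! _"] by (auto simp: fs_def)
  have word: "map (\<lambda>f. f w) fs = \<rho> (F w)" for w
  proof -
    have "\<rho> (F w) \<in> bvecs k" using \<rho>(1) F(2) by blast
    then have "length (\<rho> (F w)) = k" by (simp add: bvecs_def)
    then show ?thesis by (auto simp: fs_def list_eq_iff_nth_eq)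
  qed
  have run: "run (op_delta A) (\<lambda>w. map (\<lambda>f. f w) fs) q0 w = run (trans_fun D) F q0 w" for w
    using F(2) by (intro run_cong) (simp add: A_def word \<phi>\<rho> range_subsetD)
  have range: "run (trans_fun D) F q0 w \<in> {1..n}" for w
    using q0 F(2) by (intro run_in semi) auto
  have "(\<lambda>w. run (trans_fun D) F q0 w = i) \<in> signals m" for i
  proof (cases "i \<in> {1..n}")
    case True
    then have "(\<lambda>w. run (op_delta A) (\<lambda>w. map (\<lambda>f. f w) fs) (op_init A) w = i) \<in> signals m"
      by (intro signals.dynamic A fs) (simp_all add: A_def fs_def)
    then show ?thesis using run by (simp add: A_def)
  next
    case False
    then have "run (trans_fun D) F q0 w \<noteq> i" for w using range[of w] by auto
    then show ?thesis by (simp add: signals_False)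
  qed
  moreover have "finite (range (run (trans_fun D) F q0))"
    by (rule finite_subset[of _ "{1..n}"]) (use range in auto)
  ultimately show ?thesis by (simp add: computable_def)
qed

lemma run_hom:
  assumes "q \<in> S" "\<And>q w. q \<in> S \<Longrightarrow> \<delta> q (F w) \<in> S"
    and "\<And>q w. q \<in> S \<Longrightarrow> h (\<delta> q (F w)) = \<delta>' (h q) (F' w)"
  shows "h (run \<delta> F q w) = run \<delta>' F' (h q) w"
  by (induction w rule: rev_induct) (simp_all add: assms run_in)

definition latch :: "'a \<Rightarrow> bool \<times> 'a \<Rightarrow> 'a" where
  "latch x v = (if fst v then snd v else x)"

lemma signals_latch:
  assumes "L \<in> signals m" "V \<in> signals m"
  shows "run latch (\<lambda>w. (L w, V w)) b \<in> signals m"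
proof -
  \<comment> \<open>Letters 0, 1, 2 are read, set and reset, and states 1, 2 are high and low; any
    letter other than read is thus its own target state.\<close>
  define D :: "(nat, nat) semiautomaton" where
    "D = \<lparr>alphabet = {0..2}, states = {1..2}, trans_fun = (\<lambda>q a. if a = 0 then q else a)\<rparr>"
  have D0: "{0..2::nat} = {0, 1, 2}" "{1..2::nat} = {1, 2}" by auto
  have "isomorphic D canonical_flipflop"
    unfolding isomorphic_def
  proof (intro exI conjI)
    show "bij_betw (\<lambda>a::nat. if a = 0 then Read else if a = 1 then Set else Reset) (alphabet D) (alphabet canonical_flipflop)"
      unfolding bij_betw_def canonical_flipflop_def D_def D0
      by (auto simp: inj_on_def split: if_splits) (metis flipflop_input.exhaust)
    show "bij_betw (\<lambda>a::nat. if a = 1 then High else Low) (states D) (states canonical_flipflop)"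
      unfolding bij_betw_def canonical_flipflop_def D_def D0
      by (auto simp: inj_on_def split: if_splits) (metis flipflop_state.exhaust)
  qed (unfold canonical_flipflop_def D_def D0, auto)
  then have "prime_semiautomaton D"
    by (auto simp: prime_semiautomaton_def is_semiautomaton_def D_def)
  moreover define F where "F = (\<lambda>w. if L w then if V w then 1 else 2 else 0 :: nat)"
  moreover have "computable m F"
    unfolding F_def by (intro computable_if computable_const assms)
  ultimately have "computable m (run (trans_fun D) F (if b then 1 else 2))"
    by (intro computable_prime_run[where n = 2]) (auto simp: D_def F_def)
  then have "(\<lambda>w. run (trans_fun D) F (if b then 1 else 2) w = 1) \<in> signals m"
    by (rule computable_pred)
  moreover have "(run (trans_fun D) F (if b then 1 else 2) w = 1) = run latch (\<lambda>w. (L w, V w)) b w" for w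
    by (rule run_unique) (auto simp: D_def F_def latch_def)
  ultimately show ?thesis by simp
qed

text \<open>One Boolean latch per value \<open>a\<close> suffices: whether the stored value is
  \<open>a\<close> is itself a latch, loading whether the new value is \<open>a\<close>.\<close>

lemma computable_latch:
  assumes "L \<in> signals m" "computable m V"
  shows "computable m (run latch (\<lambda>w. (L w, V w)) v)"
proof -
  have "(run latch (\<lambda>w. (L w, V w)) v w = a) = run latch (\<lambda>w. (L w, V w = a)) (v = a) w" for a w
    by (rule run_unique) (auto simp: latch_def)
  moreover have "run latch (\<lambda>w. (L w, V w = a)) (v = a) \<in> signals m" for a
    using assms by (intro signals_latch) (auto simp: computable_def)
  moreover have "finite (range (run latch (\<lambda>w. (L w, V w)) v))"
  proof (rule finite_subset)
    show "range (run latch (\<lambda>w. (L w, V w)) v) \<subseteq> insert v (range V)"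
      by (intro image_subsetI run_in) (auto simp: latch_def)
  qed (use assms in \<open>simp add: computable_def\<close>)
  ultimately show ?thesis by (simp add: computable_def)
qed

section \<open>Running products in groups\<close>

definition products_computable :: "nat \<Rightarrow> 'a monoid \<Rightarrow> bool" where
  "products_computable m G \<longleftrightarrow>
     (\<forall>F. computable m F \<longrightarrow> range F \<subseteq> carrier G \<longrightarrow> computable m (run (mult G) F \<one>\<^bsub>G\<^esub>))"

lemma products_computable_simple:
  fixes G :: "nat monoid"
  assumes G: "is_simple_group G" "finite (carrier G)"
  shows "products_computable m G"
  unfolding products_computable_def
proof (intro allI impI)
  interpret group G using G by (simp add: is_simple_group_def)
  fix F :: "bool list list \<Rightarrow> nat"
  assume F: "computable m F" "range F \<subseteq> carrier G"
  define n where "n = card (carrier G)"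
  obtain h where h: "bij_betw h {1..n} (carrier G)"
    using ex_bij_betw_nat_finite_1[OF G(2)] by (auto simp: n_def)
  define h' where "h' = inv_into {1..n} h"
  have h': "h' x \<in> {1..n}" "h (h' x) = x" if "x \<in> carrier G" for x
    using that h unfolding h'_def bij_betw_def by (metis inv_into_into, metis f_inv_into_f)
  have hG: "h q \<in> carrier G" if "q \<in> {1..n}" for q
    using that h by (auto simp: bij_betw_def)
  \<comment> \<open>Operator states are the numbers from 1 to \<open>n\<close>, so only the states
    are renumbered by \<open>h\<close>; the letters remain group elements, which are already natural
    numbers.\<close>
  define D :: "(nat, nat) semiautomaton" where
    "D = \<lparr>alphabet = carrier G, states = {1..n}, trans_fun = (\<lambda>q a. h' (h q \<otimes>\<^bsub>G\<^esub> a))\<rparr>"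
  have "isomorphic D (monoid_semiautomaton G)"
    unfolding isomorphic_def monoid_semiautomaton_def
    by (rule exI[of _ id], rule exI[of _ h]) (use h h' hG in \<open>auto simp: D_def insert_absorb\<close>)
  moreover have "is_semiautomaton D"
    using h' hG by (auto simp: is_semiautomaton_def D_def)
  ultimately have "prime_semiautomaton D"
    using G(1) by (auto simp: prime_semiautomaton_def)
  then have "computable m (run (trans_fun D) F (h' \<one>\<^bsub>G\<^esub>))"
    by (rule computable_prime_run) (use G F h' in \<open>auto simp: D_def\<close>)
  then have "computable m (\<lambda>w. h (run (trans_fun D) F (h' \<one>\<^bsub>G\<^esub>) w))"
    by (rule computable_map)
  moreover have "h (run (trans_fun D) F (h' \<one>\<^bsub>G\<^esub>) w) = run (mult G) F (h (h' \<one>\<^bsub>G\<^esub>)) w" for w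
  proof (rule run_hom[where S = "{1..n}"])
    fix q w assume "q \<in> {1..n}"
    then have "h q \<otimes>\<^bsub>G\<^esub> F w \<in> carrier G" using F(2) hG by blast
    then show "trans_fun D q (F w) \<in> {1..n}" "h (trans_fun D q (F w)) = h q \<otimes>\<^bsub>G\<^esub> F w"
      using h' by (simp_all add: D_def)
  qed (use h' in simp)
  ultimately show "computable m (run (mult G) F \<one>\<^bsub>G\<^esub>)"
    using h' by simp
qed

text \<open>With a section \<open>s\<close> of \<open>\<pi>\<close>, running products \<open>P\<close> in \<open>G\<close> are recovered from
  \<open>s \<one> \<otimes> P = n \<otimes> s (\<pi> P)\<close>, where \<open>n\<close> is itself a running product in \<open>N\<close>.\<close>

lemma products_computable_extension:
  fixes G :: "'a monoid" and H :: "'b monoid"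
  assumes G: "group G" and H: "group H" and N: "subgroup N G"
    and \<pi>: "\<pi> \<in> hom G H" "\<pi> ` carrier G = carrier H"
    and ker: "kernel G H \<pi> = N"
    and "products_computable m H" "products_computable m (G\<lparr>carrier := N\<rparr>)"
  shows "products_computable m G"
  unfolding products_computable_def
proof (intro allI impI)
  interpret G: group G by fact
  interpret H: group H by fact
  interpret \<pi>: group_hom G H \<pi> by unfold_locales fact
  fix F :: "bool list list \<Rightarrow> 'a"
  assume F: "computable m F" "range F \<subseteq> carrier G"
  define s where "s = inv_into (carrier G) \<pi>"
  have s: "s y \<in> carrier G" "\<pi> (s y) = y" if "y \<in> carrier H" for y
    using that \<pi>(2) by (auto simp: s_def f_inv_into_f inv_into_into)
  define h where "h = run (mult H) (\<lambda>w. \<pi> (F w)) \<one>\<^bsub>H\<^esub>"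
  have FG: "F w \<in> carrier G" for w using F(2) by auto
  have h_in: "h w \<in> carrier H" for w unfolding h_def by (rule run_in) (use FG in auto)
  have h: "computable m h"
    using assms(7) computable_map[OF F(1), of \<pi>] FG unfolding products_computable_def h_def by auto
  \<comment> \<open>The inner conditional is redundant but gives the term the shape of a delayed signal.\<close>
  define K where "K w = (if w = [] then \<one>\<^bsub>G\<^esub> else
    s (if w = [] then undefined else h (butlast w)) \<otimes>\<^bsub>G\<^esub> F w \<otimes>\<^bsub>G\<^esub> inv\<^bsub>G\<^esub> (s (h w)))" for w
  have K: "computable m K"
    unfolding K_def
    by (intro computable_if computable_const computable_map2[where g = "mult G"] F(1)
        computable_map[where g = s] computable_delay computable_map[where g = "\<lambda>y. inv\<^bsub>G\<^esub> (s y)"] h)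
       (use signals.neg[OF signals_nonempty] in simp)
  \<comment> \<open>The representative of the old coset times \<open>F w\<close> and the
    representative of the new coset have the same image in \<open>H\<close>, so they differ by an
    element of the kernel.\<close>
  have "K w \<in> N" for w
  proof (cases w rule: rev_cases)
    case Nil
    then show ?thesis using N by (simp add: K_def subgroup.one_closed)
  next
    case (snoc u a)
    have "\<pi> (K w) = h u \<otimes>\<^bsub>H\<^esub> \<pi> (F w) \<otimes>\<^bsub>H\<^esub> inv\<^bsub>H\<^esub> (h w)"
      using snoc FG s h_in by (simp add: K_def)
    also have "h u \<otimes>\<^bsub>H\<^esub> \<pi> (F w) = h w" by (simp add: snoc h_def)
    finally have "\<pi> (K w) = \<one>\<^bsub>H\<^esub>" using h_in by simp
    then show ?thesis using snoc FG s h_in by (auto simp: K_def ker[symmetric] kernel_def)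
  qed
  then have KN: "range K \<subseteq> N" by auto
  define n where "n = run (mult G) K \<one>\<^bsub>G\<^esub>"
  have n: "computable m n"
    using assms(8) K KN by (auto simp: products_computable_def n_def)
  have KG: "K w \<in> carrier G" for w using KN subgroup.subset[OF N] by auto
  have n_in: "n w \<in> carrier G" for w unfolding n_def by (rule run_in) (use KG in auto)
  have P_in: "run (mult G) F \<one>\<^bsub>G\<^esub> w \<in> carrier G" for w by (rule run_in) (use FG in auto)
  \<comment> \<open>The section may send the identity to another element of \<open>N\<close>, which
    accounts for the factor on the left.\<close>
  have eq: "s \<one>\<^bsub>H\<^esub> \<otimes>\<^bsub>G\<^esub> run (mult G) F \<one>\<^bsub>G\<^esub> w = n w \<otimes>\<^bsub>G\<^esub> s (h w)" for w
  proof (induction w rule: rev_induct)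
    case Nil
    show ?case using s by (simp add: n_def h_def)
  next
    case (snoc a w)
    let ?w = "w @ [a]"
    have "s \<one>\<^bsub>H\<^esub> \<otimes>\<^bsub>G\<^esub> run (mult G) F \<one>\<^bsub>G\<^esub> ?w = (n w \<otimes>\<^bsub>G\<^esub> s (h w)) \<otimes>\<^bsub>G\<^esub> F ?w"
      using s P_in FG by (simp add: snoc.IH[symmetric] G.m_assoc)
    also have "\<dots> = n w \<otimes>\<^bsub>G\<^esub> K ?w \<otimes>\<^bsub>G\<^esub> s (h ?w)"
      using s h_in n_in FG by (simp add: K_def G.m_assoc)
    finally show ?case by (simp add: n_def)
  qed
  have "run (mult G) F \<one>\<^bsub>G\<^esub> w = inv\<^bsub>G\<^esub> (s \<one>\<^bsub>H\<^esub>) \<otimes>\<^bsub>G\<^esub> (n w \<otimes>\<^bsub>G\<^esub> s (h w))" for w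
    using s P_in by (simp add: eq[symmetric] G.m_assoc[symmetric])
  then have "run (mult G) F \<one>\<^bsub>G\<^esub> = (\<lambda>w. inv\<^bsub>G\<^esub> (s \<one>\<^bsub>H\<^esub>) \<otimes>\<^bsub>G\<^esub> (n w \<otimes>\<^bsub>G\<^esub> s (h w)))" by auto
  moreover have "computable m (\<lambda>w. inv\<^bsub>G\<^esub> (s \<one>\<^bsub>H\<^esub>) \<otimes>\<^bsub>G\<^esub> (n w \<otimes>\<^bsub>G\<^esub> s (h w)))"
    using computable_map2[OF n h, of "\<lambda>x y. inv\<^bsub>G\<^esub> (s \<one>\<^bsub>H\<^esub>) \<otimes>\<^bsub>G\<^esub> (x \<otimes>\<^bsub>G\<^esub> s y)"] .
  ultimately show "computable m (run (mult G) F \<one>\<^bsub>G\<^esub>)" by simp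
qed

text \<open>This is \<open>G / N\<close> with its cosets numbered. Prime semiautomata with numbered
  states come from groups on natural numbers, and the induction over groups can then stay within
  that one type.\<close>

lemma nat_quotient_group:
  fixes G :: "'a monoid"
  assumes G: "group G" "finite (carrier G)" and N: "N \<lhd> G"
  obtains H :: "nat monoid" and \<pi> where "group H" "\<pi> \<in> hom G H" "\<pi> ` carrier G = carrier H"
    "kernel G H \<pi> = N" "card (carrier H) * card N = card (carrier G)"
proof -
  interpret N: normal N G by fact
  have "finite (rcosets\<^bsub>G\<^esub> N)" using G(2) by (simp add: RCOSETS_def)
  then obtain e :: "'a set \<Rightarrow> nat" where e: "inj_on e (rcosets\<^bsub>G\<^esub> N)"
    using finite_imp_inj_to_nat_seg by blast
  define \<pi> where "\<pi> x = e (N #>\<^bsub>G\<^esub> x)" for x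
  have coset: "N #>\<^bsub>G\<^esub> x \<in> rcosets\<^bsub>G\<^esub> N" if "x \<in> carrier G" for x
    using that by (auto simp: RCOSETS_def)
  have \<pi>: "weak_group_morphism \<pi> N G"
  proof (rule weak_group_morphismsI[OF N])
    fix a b assume ab: "a \<in> carrier G" "b \<in> carrier G"
    have "\<pi> a = \<pi> b \<longleftrightarrow> N #>\<^bsub>G\<^esub> a = N #>\<^bsub>G\<^esub> b"
      using e coset ab by (auto simp: \<pi>_def inj_on_def)
    also have "\<dots> \<longleftrightarrow> a \<in> N #>\<^bsub>G\<^esub> b"
      using ab N.rcos_self N.repr_independence[of a N b] N.subgroup_axioms by blast
    also have "\<dots> \<longleftrightarrow> a \<otimes>\<^bsub>G\<^esub> inv\<^bsub>G\<^esub> b \<in> N"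
      using ab by (simp add: N.rcos_module[OF N.is_group])
    finally show "\<pi> a = \<pi> b \<longleftrightarrow> a \<otimes>\<^bsub>G\<^esub> inv\<^bsub>G\<^esub> b \<in> N" .
  qed
  have "\<pi> ` carrier G = e ` (rcosets\<^bsub>G\<^esub> N)" by (auto simp: \<pi>_def RCOSETS_def)
  then have "card (\<pi> ` carrier G) = card (rcosets\<^bsub>G\<^esub> N)" using e by (simp add: card_image)
  then have "card (\<pi> ` carrier G) * card N = card (carrier G)"
    using N.lagrange[OF N.subgroup_axioms] by (simp add: order_def)
  then show thesis
    using N.weak_group_morphism_ker[OF \<pi>] N.image_group_is_group[OF \<pi>] N.weak_group_morphism_is_hom[OF \<pi>]
    by (intro that[of "image_group \<pi> G" \<pi>]) (simp_all add: image_group_carrier)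
qed

lemma products_computable_nat_group:
  fixes G :: "nat monoid"
  assumes "group G" "finite (carrier G)"
  shows "products_computable m G"
  using assms
proof (induction "card (carrier G)" arbitrary: G rule: less_induct)
  case less
  interpret G: group G by fact
  show ?case
  proof (cases "is_simple_group G")
    case True
    then show ?thesis using less.prems by (simp add: products_computable_simple)
  next
    case False
    then obtain N where N: "N \<lhd> G" "N \<noteq> {\<one>\<^bsub>G\<^esub>}" "N \<noteq> carrier G"
      using less.prems by (auto simp: is_simple_group_def)
    interpret N: normal N G by fact
    obtain H :: "nat monoid" and \<pi> where H: "group H" "\<pi> \<in> hom G H" "\<pi> ` carrier G = carrier H"
      "kernel G H \<pi> = N"
      and card: "card (carrier H) * card N = card (carrier G)"
      using nat_quotient_group[OF less.prems N(1)] by blast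
    have finN: "finite N" using N.subset less.prems(2) by (rule finite_subset)
    have "card N < card (carrier G)"
      using N.subset N(3) less.prems(2) by (simp add: psubset_card_mono psubset_eq)
    moreover have "card N \<noteq> 1"
      using N(2) subgroup.one_closed[OF N.subgroup_axioms] by (metis card_1_singletonE singletonD)
    moreover have "card (carrier G) > 0" using less.prems(2) by (auto simp: card_gt_0_iff)
    \<comment> \<open>By Lagrange the orders of \<open>H\<close> and \<open>N\<close> multiply to
      that of \<open>G\<close>; as \<open>N\<close> is nontrivial, the quotient is smaller than
      \<open>G\<close>.\<close>
    ultimately have "card (carrier H) < card (carrier G)"
      using card by (cases "card (carrier H)"; cases "card N") auto
    moreover have "finite (carrier H)" using H(3) less.prems(2) by (metis finite_imageI)
    ultimately have "products_computable m H" using less.hyps H(1) by blast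
    moreover have "products_computable m (G\<lparr>carrier := N\<rparr>)"
      using less.hyps[of "G\<lparr>carrier := N\<rparr>"] \<open>card N < card (carrier G)\<close> finN
        G.subgroup_imp_group[OF N.subgroup_axioms] by simp
    ultimately show ?thesis
      using products_computable_extension[OF less.prems(1) H(1) N.subgroup_axioms H(2-4)] by blast
  qed
qed

text \<open>The quotient by the trivial subgroup is a copy of \<open>G\<close> on natural numbers.
  The extension lemma carries the result back, products in the trivial subgroup being
  constant.\<close>

lemma products_computable_group:
  fixes G :: "'a monoid"
  assumes "group G" "finite (carrier G)"
  shows "products_computable m G"
proof -
  interpret G: group G by fact
  define N where "N = {\<one>\<^bsub>G\<^esub>}"
  have N: "N \<lhd> G" unfolding N_def by (rule G.one_is_normal)
  obtain H :: "nat monoid" and \<pi> where H: "group H" "\<pi> \<in> hom G H" "\<pi> ` carrier G = carrier H"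
    "kernel G H \<pi> = N" "card (carrier H) * card N = card (carrier G)"
    using nat_quotient_group[OF assms N] by blast
  have "finite (carrier H)" using H(3) assms(2) by (metis finite_imageI)
  moreover have "products_computable m (G\<lparr>carrier := N\<rparr>)"
    unfolding products_computable_def
  proof (intro allI impI)
    fix F :: "bool list list \<Rightarrow> 'a"
    assume "range F \<subseteq> carrier (G\<lparr>carrier := N\<rparr>)"
    then have "F w = \<one>\<^bsub>G\<^esub>" for w by (auto simp: N_def)
    then have "run (mult G) F \<one>\<^bsub>G\<^esub> w = \<one>\<^bsub>G\<^esub>" for w
      by (induction w rule: rev_induct) simp_all
    then have "run (mult G) F \<one>\<^bsub>G\<^esub> = (\<lambda>w. \<one>\<^bsub>G\<^esub>)" by auto
    then show "computable m (run (mult (G\<lparr>carrier := N\<rparr>)) F \<one>\<^bsub>G\<lparr>carrier := N\<rparr>\<^esub>)"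
      by (simp add: computable_const)
  qed
  ultimately show ?thesis
    using products_computable_extension[OF assms(1) H(1) normal_imp_subgroup[OF N] H(2-4)]
      products_computable_nat_group[OF H(1)] by blast
qed

section \<open>Running products in monoids\<close>

text \<open>The letter \<open>None\<close> restarts the product. Cutting words at an element yields
  products that restart at each cut, so resets are built in to let the induction pass to such
  products.\<close>

definition reset_mult :: "('a, 'b) monoid_scheme \<Rightarrow> 'a \<Rightarrow> 'a option \<Rightarrow> 'a" where
  "reset_mult M x a = (case a of None \<Rightarrow> \<one>\<^bsub>M\<^esub> | Some y \<Rightarrow> x \<otimes>\<^bsub>M\<^esub> y)"

lemma reset_mult_simps [simp]:
  "reset_mult M x None = \<one>\<^bsub>M\<^esub>" "reset_mult M x (Some y) = x \<otimes>\<^bsub>M\<^esub> y"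
  by (simp_all add: reset_mult_def)

definition product :: "('a, 'b) monoid_scheme \<Rightarrow> ('s list \<Rightarrow> 'a option) \<Rightarrow> 's list \<Rightarrow> 'a" where
  "product M F = run (reset_mult M) F \<one>\<^bsub>M\<^esub>"

lemma product_Nil [simp]: "product M F [] = \<one>\<^bsub>M\<^esub>"
  and product_snoc [simp]: "product M F (w @ [a]) = reset_mult M (product M F w) (F (w @ [a]))"
  by (simp_all add: product_def)

lemma (in monoid) product_closed:
  assumes "\<And>w. F w \<in> insert None (Some ` carrier G)"
  shows "product G F w \<in> carrier G"
proof (induction w rule: rev_induct)
  case (snoc a w)
  then show ?case using assms[of "w @ [a]"] by auto
qed simp

text \<open>If the running product since the start was \<open>y\<close> at the last reset and is \<open>q\<close> now,
  then the running product since the last reset is \<open>inv y \<otimes> q\<close>.\<close>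

lemma product_computable_group:
  fixes G :: "'a monoid"
  assumes G: "group G" "finite (carrier G)"
    and F: "computable m F" "\<And>w. F w \<in> insert None (Some ` carrier G)"
  shows "computable m (product G F)"
proof -
  interpret group G by fact
  define F' where "F' w = (case F w of None \<Rightarrow> \<one>\<^bsub>G\<^esub> | Some x \<Rightarrow> x)" for w
  have F': "F' w \<in> carrier G" for w using F(2)[of w] by (auto simp: F'_def)
  define q where "q = run (mult G) F' \<one>\<^bsub>G\<^esub>"
  have "computable m F'" unfolding F'_def by (rule computable_map[OF F(1)])
  then have q: "computable m q"
    using products_computable_group[OF G, of m] F' by (auto simp: products_computable_def q_def)
  have q_in: "q w \<in> carrier G" for w unfolding q_def by (rule run_in) (use F' in auto)
  define y where "y = run latch (\<lambda>w. (F w = None, q w)) \<one>\<^bsub>G\<^esub>"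
  have y: "computable m y"
    unfolding y_def by (rule computable_latch) (use F(1) q in \<open>auto simp: computable_def\<close>)
  have y_in: "y w \<in> carrier G" for w
    unfolding y_def by (rule run_in) (use q_in in \<open>auto simp: latch_def\<close>)
  have "product G F w = inv\<^bsub>G\<^esub> (y w) \<otimes>\<^bsub>G\<^esub> q w" for w
  proof (induction w rule: rev_induct)
    case Nil
    show ?case by (simp add: y_def q_def)
  next
    case (snoc a w)
    show ?case
    proof (cases "F (w @ [a])")
      case None
      then have "y (w @ [a]) = q (w @ [a])" by (simp add: y_def latch_def)
      then show ?thesis using None q_in by simp
    next
      case (Some x)
      then have "y (w @ [a]) = y w" "q (w @ [a]) = q w \<otimes>\<^bsub>G\<^esub> x"
        by (simp_all add: y_def q_def latch_def F'_def)
      moreover have "x \<in> carrier G" using F(2)[of "w @ [a]"] Some by auto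
      ultimately show ?thesis using Some snoc q_in y_in by (simp add: m_assoc)
    qed
  qed
  then have "product G F = (\<lambda>w. inv\<^bsub>G\<^esub> (y w) \<otimes>\<^bsub>G\<^esub> q w)" by auto
  then show ?thesis
    using computable_map2[OF y q, of "\<lambda>y q. inv\<^bsub>G\<^esub> y \<otimes>\<^bsub>G\<^esub> q"] by simp
qed

section \<open>The local divisor \<open>c M \<inter> M c\<close>, where \<open>a c\<close> times
  \<open>c b\<close> is \<open>a c b\<close>\<close>

definition local_divisor :: "('a, 'b) monoid_scheme \<Rightarrow> 'a \<Rightarrow> 'a monoid" where
  "local_divisor M c =
     \<lparr>carrier = {x. (\<exists>a\<in>carrier M. x = a \<otimes>\<^bsub>M\<^esub> c) \<and> (\<exists>b\<in>carrier M. x = c \<otimes>\<^bsub>M\<^esub> b)},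
      monoid.mult = (\<lambda>x y. (SOME a. a \<in> carrier M \<and> x = a \<otimes>\<^bsub>M\<^esub> c) \<otimes>\<^bsub>M\<^esub> y), one = c\<rparr>"

lemma local_divisor_one: "\<one>\<^bsub>local_divisor M c\<^esub> = c"
  by (simp add: local_divisor_def)

context monoid
begin

lemma local_divisor_carrierE:
  assumes "x \<in> carrier (local_divisor G c)"
  obtains a b where "a \<in> carrier G" "x = a \<otimes> c" "b \<in> carrier G" "x = c \<otimes> b"
  using assms by (auto simp: local_divisor_def)

lemma local_divisor_carrierI:
  assumes "a \<in> carrier G" "b \<in> carrier G" "x = a \<otimes> c" "x = c \<otimes> b"
  shows "x \<in> carrier (local_divisor G c)"
proof -
  have "(\<exists>a\<in>carrier G. x = a \<otimes> c) \<and> (\<exists>b\<in>carrier G. x = c \<otimes> b)" using assms by blast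
  then show ?thesis by (simp add: local_divisor_def)
qed

text \<open>The product does not depend on the left factor chosen: if \<open>a c = d c\<close> and
  \<open>y = c b\<close>, then \<open>a y = a c b = d c b = d y\<close>.\<close>

lemma local_divisor_mult:
  assumes "c \<in> carrier G" "a \<in> carrier G" "y \<in> carrier (local_divisor G c)"
  shows "(a \<otimes> c) \<otimes>\<^bsub>local_divisor G c\<^esub> y = a \<otimes> y"
proof -
  obtain b where b: "b \<in> carrier G" "y = c \<otimes> b" using assms(3) by (rule local_divisor_carrierE)
  define d where "d = (SOME d. d \<in> carrier G \<and> a \<otimes> c = d \<otimes> c)"
  have "d \<in> carrier G \<and> a \<otimes> c = d \<otimes> c"
    unfolding d_def by (rule someI[of _ a]) (use assms in auto)
  then have "d \<otimes> y = a \<otimes> y" using assms b by (metis m_assoc)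
  then show ?thesis by (simp add: local_divisor_def d_def)
qed

lemma local_divisor_subset:
  assumes "c \<in> carrier G"
  shows "carrier (local_divisor G c) \<subseteq> carrier G"
  using assms by (auto elim: local_divisor_carrierE)

text \<open>If the local divisor contained \<one>, then \<open>c\<close> would have a left and a
  right inverse and be a unit.\<close>

lemma local_divisor_psubset:
  assumes "c \<in> carrier G" "c \<notin> Units G"
  shows "carrier (local_divisor G c) \<subset> carrier G"
proof -
  have "\<one> \<notin> carrier (local_divisor G c)"
  proof
    assume "\<one> \<in> carrier (local_divisor G c)"
    then obtain a b where ab: "a \<in> carrier G" "\<one> = a \<otimes> c" "b \<in> carrier G" "\<one> = c \<otimes> b"
      by (rule local_divisor_carrierE)
    then have "a = b" using assms(1) inv_unique by metis
    then show False using ab assms by (auto simp: Units_def)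
  qed
  then show ?thesis using local_divisor_subset[OF assms(1)] by auto
qed

lemma local_divisor_mult_closed:
  assumes c: "c \<in> carrier G"
    and "x \<in> carrier (local_divisor G c)" "y \<in> carrier (local_divisor G c)"
  shows "x \<otimes>\<^bsub>local_divisor G c\<^esub> y \<in> carrier (local_divisor G c)"
proof -
  obtain a b where x: "a \<in> carrier G" "x = a \<otimes> c" "b \<in> carrier G" "x = c \<otimes> b"
    using assms(2) by (rule local_divisor_carrierE)
  obtain a' b' where y: "a' \<in> carrier G" "y = a' \<otimes> c" "b' \<in> carrier G" "y = c \<otimes> b'"
    using assms(3) by (rule local_divisor_carrierE)
  have "a \<otimes> y = (a \<otimes> a') \<otimes> c" using x y c by (simp add: m_assoc)
  moreover have "a \<otimes> y = c \<otimes> (b \<otimes> b')" using x y c by (metis m_assoc)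
  ultimately show ?thesis
    using local_divisor_mult[OF c x(1) assms(3)] x y
    by (intro local_divisor_carrierI[of "a \<otimes> a'" "b \<otimes> b'"]) simp_all
qed

lemma local_divisor_one_closed:
  assumes "c \<in> carrier G"
  shows "c \<in> carrier (local_divisor G c)"
  using assms by (intro local_divisor_carrierI[of \<one> \<one>]) simp_all

lemma local_divisor_monoid:
  assumes c: "c \<in> carrier G"
  shows "monoid (local_divisor G c)"
proof
  fix x y assume xy: "x \<in> carrier (local_divisor G c)" "y \<in> carrier (local_divisor G c)"
  then show "x \<otimes>\<^bsub>local_divisor G c\<^esub> y \<in> carrier (local_divisor G c)"
    by (rule local_divisor_mult_closed[OF c])
  obtain a where x: "a \<in> carrier G" "x = a \<otimes> c" using xy(1) by (rule local_divisor_carrierE)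
  obtain a' where y: "a' \<in> carrier G" "y = a' \<otimes> c" using xy(2) by (rule local_divisor_carrierE)
  fix z assume z: "z \<in> carrier (local_divisor G c)"
  have zG: "z \<in> carrier G" using z local_divisor_subset[OF c] by blast
  have "a \<otimes> y = (a \<otimes> a') \<otimes> c" using x y c by (simp add: m_assoc)
  then have "(x \<otimes>\<^bsub>local_divisor G c\<^esub> y) \<otimes>\<^bsub>local_divisor G c\<^esub> z = (a \<otimes> a') \<otimes> z"
    using x y z xy c by (simp add: local_divisor_mult)
  moreover have "x \<otimes>\<^bsub>local_divisor G c\<^esub> (y \<otimes>\<^bsub>local_divisor G c\<^esub> z) = a \<otimes> (a' \<otimes> z)"
    unfolding x(2) local_divisor_mult[OF c x(1) local_divisor_mult_closed[OF c xy(2) z]]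
    unfolding y(2) local_divisor_mult[OF c y(1) z] ..
  ultimately show "x \<otimes>\<^bsub>local_divisor G c\<^esub> y \<otimes>\<^bsub>local_divisor G c\<^esub> z =
      x \<otimes>\<^bsub>local_divisor G c\<^esub> (y \<otimes>\<^bsub>local_divisor G c\<^esub> z)"
    using x y zG by (simp add: m_assoc)
next
  show "\<one>\<^bsub>local_divisor G c\<^esub> \<in> carrier (local_divisor G c)"
    using local_divisor_one_closed[OF c] by (simp add: local_divisor_one)
next
  fix x assume x: "x \<in> carrier (local_divisor G c)"
  then have xG: "x \<in> carrier G" using local_divisor_subset[OF c] by blast
  show "\<one>\<^bsub>local_divisor G c\<^esub> \<otimes>\<^bsub>local_divisor G c\<^esub> x = x"
    using local_divisor_mult[OF c one_closed x] c xG by (simp add: local_divisor_one)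
  obtain a where a: "a \<in> carrier G" "x = a \<otimes> c" using x by (rule local_divisor_carrierE)
  show "x \<otimes>\<^bsub>local_divisor G c\<^esub> \<one>\<^bsub>local_divisor G c\<^esub> = x"
    using local_divisor_mult[OF c a(1) local_divisor_one_closed[OF c]] a
    by (simp add: local_divisor_one)
qed

end

text \<open>The induction step of the Krohn--Rhodes theorem. Cutting the input since the last reset at
  every occurrence of \<open>c\<close> as \<open>u\<^sub>0 c u\<^sub>1 c \<dots> c u\<^sub>k\<close>, its product is that of \<open>u\<^sub>0\<close> (held in a latch),
  times \<open>c u\<^sub>1 c \<dots> c u\<^bsub>k-1\<^esub> c\<close> (a product in the local divisor), times that of \<open>u\<^sub>k\<close>
  (a product that resets at \<open>c\<close>).\<close>

lemma product_computable_cut: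
  fixes M :: "'a monoid"
  assumes M: "monoid M" and c: "c \<in> carrier M"
    and F: "computable m F" "\<And>w. F w \<in> insert None (Some ` carrier M)"
    and rest: "\<And>F'. computable m F' \<Longrightarrow> (\<And>w. F' w = F w \<and> F w \<noteq> Some c \<or> F' w = None) \<Longrightarrow>
      computable m (product M F')"
    and local: "\<And>F'. computable m F' \<Longrightarrow>
      (\<And>w. F' w \<in> insert None (Some ` carrier (local_divisor M c))) \<Longrightarrow>
      computable m (product (local_divisor M c) F')"
  shows "computable m (product M F)"
proof -
  interpret monoid M by fact
  let ?L = "local_divisor M c"
  interpret L: monoid ?L by (rule local_divisor_monoid[OF c])
  \<comment> \<open>\<open>U\<close> is the product since the last reset or occurrence of
    \<open>c\<close>, that is, of the current block \<open>u\<^sub>k\<close>.\<close>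
  define U where "U = product M (\<lambda>w. if F w = Some c then None else F w)"
  have U: "computable m U"
    unfolding U_def
  proof (rule rest)
    show "computable m (\<lambda>w. if F w = Some c then None else F w)"
      by (rule computable_map[OF F(1), of "\<lambda>x. if x = Some c then None else x"])
  qed auto
  have U_in: "U w \<in> carrier M" for w
    unfolding U_def using F(2) by (intro product_closed) auto
  \<comment> \<open>\<open>H\<close> records whether \<open>c\<close> has occurred since the last
    reset. \<open>H'\<close> and \<open>U'\<close> below are the values just before the current
    letter.\<close>
  define H where "H = run latch (\<lambda>w. (F w = None \<or> F w = Some c, F w \<noteq> None)) False"
  have H: "computable m H"
    unfolding H_def
    by (rule computable_latch[OF computable_pred[OF F(1), of "\<lambda>x. x = None \<or> x = Some c"]
        computable_map[OF F(1)]])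
  define H' where "H' w = (if w = [] then False else H (butlast w))" for w
  define U' where "U' w = (if w = [] then \<one>\<^bsub>M\<^esub> else U (butlast w))" for w
  have H': "computable m H'" and U': "computable m U'"
    unfolding H'_def U'_def by (rule computable_delay, fact)+
  \<comment> \<open>At the first \<open>c\<close> after a reset, the latch stores the product of the
    block \<open>u\<^sub>0\<close> that has just ended.\<close>
  define V where "V = run latch (\<lambda>w. (F w = Some c \<and> \<not> H' w, U' w)) \<one>\<^bsub>M\<^esub>"
  have FH: "computable m (\<lambda>w. (F w, H' w))" by (rule computable_Pair[OF F(1) H'])
  have V: "computable m V"
    unfolding V_def
    by (rule computable_latch[OF _ U'])
       (use computable_pred[OF FH, of "\<lambda>(x, h). x = Some c \<and> \<not> h"] in simp)
  have V_in: "V w \<in> carrier M" for w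
    unfolding V_def by (rule run_in) (use U_in in \<open>auto simp: latch_def U'_def\<close>)
  \<comment> \<open>The first \<open>c\<close> restarts the local product at its identity, which is
    \<open>c\<close> itself. A later \<open>c\<close> closes a block \<open>u\<close> and
    contributes \<open>c u c\<close>; other letters contribute the identity.\<close>
  define K where "K w = (if F w = None \<or> F w = Some c \<and> \<not> H' w then None
    else if F w = Some c then Some (c \<otimes>\<^bsub>M\<^esub> U' w \<otimes>\<^bsub>M\<^esub> c) else Some c)" for w
  have K: "computable m K"
    using computable_map2[OF FH U', of "\<lambda>(x, h) u. if x = None \<or> x = Some c \<and> \<not> h then None
      else if x = Some c then Some (c \<otimes>\<^bsub>M\<^esub> u \<otimes>\<^bsub>M\<^esub> c) else Some c"]
    by (simp add: K_def[abs_def])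
  have cUc: "c \<otimes>\<^bsub>M\<^esub> U' w \<otimes>\<^bsub>M\<^esub> c \<in> carrier ?L" for w
    using U_in c
    by (intro local_divisor_carrierI[of "c \<otimes>\<^bsub>M\<^esub> U' w" "U' w \<otimes>\<^bsub>M\<^esub> c"]) (auto simp: U'_def m_assoc)
  have K_in: "K w \<in> insert None (Some ` carrier ?L)" for w
    using cUc local_divisor_one_closed[OF c] by (auto simp: K_def)
  define X where "X = product ?L K"
  have X: "computable m X" unfolding X_def by (rule local[OF K K_in])
  have X_in: "X w \<in> carrier ?L" for w unfolding X_def by (rule L.product_closed[OF K_in])
  have XM: "X w \<in> carrier M" for w using X_in local_divisor_subset[OF c] by blast
  have eq: "product M F w = (if H w then V w \<otimes>\<^bsub>M\<^esub> X w \<otimes>\<^bsub>M\<^esub> U w else U w)" for w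
  proof (induction w rule: rev_induct)
    case Nil
    show ?case by (simp add: H_def U_def)
  next
    case (snoc a w)
    let ?w = "w @ [a]"
    have H'w: "H' ?w = H w" and U'w: "U' ?w = U w" by (simp_all add: H'_def U'_def H_def U_def)
    have step: "product M F ?w = reset_mult M (product M F w) (F ?w)"
      "U ?w = reset_mult M (U w) (if F ?w = Some c then None else F ?w)"
      "H ?w = latch (H w) (F ?w = None \<or> F ?w = Some c, F ?w \<noteq> None)"
      "V ?w = latch (V w) (F ?w = Some c \<and> \<not> H w, U w)"
      "X ?w = reset_mult ?L (X w) (K ?w)"
      by (simp_all add: U_def H_def V_def X_def H'w[unfolded H_def] U'w[unfolded U_def])
    consider (reset) "F ?w = None" | (first) "F ?w = Some c" "\<not> H w" | (again) "F ?w = Some c" "H w"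
      | (other) b where "F ?w = Some b" "b \<noteq> c" by fastforce
    then show ?case
    proof cases
      case reset
      then show ?thesis by (simp add: step latch_def)
    next
      case first
      then have "K ?w = None" by (simp add: K_def H'w)
      then show ?thesis
        using first snoc U_in c by (simp add: step latch_def local_divisor_one)
    next
      case again
      have Kw: "K ?w = Some (c \<otimes>\<^bsub>M\<^esub> U w \<otimes>\<^bsub>M\<^esub> c)" using again by (simp add: K_def H'w U'w)
      obtain x where x: "x \<in> carrier M" "X w = x \<otimes>\<^bsub>M\<^esub> c"
        using X_in by (rule local_divisor_carrierE)
      \<comment> \<open>In the local divisor \<open>x c\<close> times \<open>c u c\<close> is
        \<open>x c u c\<close>: the two adjacent copies of \<open>c\<close> are merged, so every cut
        is counted once.\<close>
      have "X ?w = x \<otimes>\<^bsub>M\<^esub> (c \<otimes>\<^bsub>M\<^esub> U w \<otimes>\<^bsub>M\<^esub> c)"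
        using local_divisor_mult[OF c x(1) cUc[of ?w]] by (simp add: step Kw x(2) U'w)
      then show ?thesis
        using again snoc U_in V_in x c by (simp add: step(1-4) latch_def m_assoc)
    next
      case other
      have Kw: "K ?w = Some c" using other by (simp add: K_def)
      have "X ?w = X w"
        using L.r_one[OF X_in] by (simp add: step Kw local_divisor_one)
      moreover have "b \<in> carrier M" using other F(2)[of ?w] by auto
      ultimately show ?thesis
        using other snoc U_in V_in XM by (simp add: step(1-4) latch_def m_assoc)
    qed
  qed
  define g where "g h v x u = (if h then v \<otimes>\<^bsub>M\<^esub> x \<otimes>\<^bsub>M\<^esub> u else u)" for h v x u
  have "product M F = (\<lambda>w. g (H w) (V w) (X w) (U w))" using eq by (auto simp: g_def)
  then show ?thesis
    using computable_map2[OF computable_Pair[OF H V] computable_Pair[OF X U],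
        of "\<lambda>(h, v) (x, u). g h v x u"] by simp
qed

text \<open>The outer induction is on the size of \<open>M\<close>, the inner one on the set
  \<open>A\<close> of letters. For a letter \<open>c\<close> that is not a unit, block products use
  only \<open>A - {c}\<close>, while the local divisor is smaller and takes its whole carrier as
  letters.\<close>

theorem product_computable:
  fixes M :: "'a monoid"
  assumes "monoid M" "finite (carrier M)" "A \<subseteq> carrier M"
    "computable m F" "\<And>w. F w \<in> insert None (Some ` A)"
  shows "computable m (product M F)"
  using assms
proof (induction "card (carrier M)" arbitrary: M A F rule: less_induct)
  case (less M)
  interpret monoid M by fact
  have "finite A" using less.prems by (metis finite_subset)
  then show ?case using less.prems(3-5)
  proof (induction A arbitrary: F rule: finite_psubset_induct)
    case (psubset A)
    have FM: "F w \<in> insert None (Some ` carrier M)" for w using psubset.prems(1) psubset.prems(3)[of w] by auto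
    show ?case
    proof (cases "A \<subseteq> Units M")
      case True
      \<comment> \<open>The group of units inherits multiplication and identity, so the running
        product may be taken there.\<close>
      have "reset_mult (units_of M) = reset_mult M"
        by (auto simp: reset_mult_def units_of_mult units_of_one fun_eq_iff split: option.split)
      then have "product M F = product (units_of M) F" by (simp add: product_def units_of_one)
      moreover have "finite (carrier (units_of M))"
        using less.prems(2) by (rule rev_finite_subset) (auto simp: units_of_carrier)
      ultimately show ?thesis
        using product_computable_group[OF units_group _ psubset.prems(2)] psubset.prems(3) True
        by (auto simp: units_of_carrier)
    next
      case False
      then obtain c where c: "c \<in> A" "c \<notin> Units M" by blast
      then have cM: "c \<in> carrier M" using psubset.prems(1) by blast
      show ?thesis
      proof (rule product_computable_cut[OF less.prems(1) cM psubset.prems(2) FM])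
        fix F' assume F': "computable m F'" "\<And>w. F' w = F w \<and> F w \<noteq> Some c \<or> F' w = None"
        have "F' w \<in> insert None (Some ` (A - {c}))" for w
          using F'(2)[of w] psubset.prems(3)[of w] by auto
        then show "computable m (product M F')"
          using psubset.IH[of "A - {c}"] c F'(1) psubset.prems(1) by blast
      next
        fix F' assume F': "computable m F'" "\<And>w. F' w \<in> insert None (Some ` carrier (local_divisor M c))"
        have "carrier (local_divisor M c) \<subset> carrier M" using cM c(2) by (rule local_divisor_psubset)
        moreover from this have "finite (carrier (local_divisor M c))"
          using less.prems(2) by (meson finite_subset psubset_imp_subset)
        ultimately show "computable m (product (local_divisor M c) F')"
          using less.hyps[OF _ local_divisor_monoid[OF cM] _ subset_refl F'] less.prems(2)
            psubset_card_mono by blast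
      qed
    qed
  qed
qed

section \<open>Regular languages are recognised\<close>

text \<open>The product applies its left factor first, so running products read a word from left to
  right. Extensional functions make the carrier finite when \<open>Q\<close> is.\<close>

definition transformation_monoid :: "'q set \<Rightarrow> ('q \<Rightarrow> 'q) monoid" where
  "transformation_monoid Q =
     \<lparr>carrier = Q \<rightarrow>\<^sub>E Q, monoid.mult = (\<lambda>f g. compose Q g f), one = (\<lambda>q\<in>Q. q)\<rparr>"

lemma transformation_monoid_carrier: "carrier (transformation_monoid Q) = Q \<rightarrow>\<^sub>E Q"
  and transformation_monoid_one: "q \<in> Q \<Longrightarrow> \<one>\<^bsub>transformation_monoid Q\<^esub> q = q"
  and transformation_monoid_mult: "q \<in> Q \<Longrightarrow> (f \<otimes>\<^bsub>transformation_monoid Q\<^esub> g) q = g (f q)"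
  by (simp_all add: transformation_monoid_def compose_def)

lemma transformation_monoid: "monoid (transformation_monoid Q)"
  by unfold_locales (auto simp: transformation_monoid_def compose_def fun_eq_iff PiE_iff extensional_def)

lemma regular_language_signal:
  assumes "regular_language (bvecs m) L"
  obtains f where "f \<in> signals m" "L = {w \<in> lists (bvecs m). f w}"
proof -
  obtain D :: "(bool list, nat) semiautomaton" and q0 T where D: "is_semiautomaton D"
    "alphabet D = bvecs m" "finite (states D)" "q0 \<in> states D"
    and L: "L = {w \<in> lists (bvecs m). foldl (trans_fun D) q0 w \<in> T}"
    using assms unfolding regular_language_def by blast
  let ?Q = "states D" and ?M = "transformation_monoid (states D)"
  \<comment> \<open>The current letter is reassembled from the input signals. The result has length
    \<open>m\<close> on every list, including the empty one, where all bits are false.\<close>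
  define letter :: "bool list list \<Rightarrow> bool list" where
    "letter = (\<lambda>w. map (\<lambda>f. f w) (map (\<lambda>i w. w \<noteq> [] \<and> last w ! i) [0..<m]))"
  have letter_bvecs: "letter w \<in> bvecs m" for w by (simp add: letter_def bvecs_def)
  have letter: "letter (w @ [a]) = a" if "a \<in> bvecs m" for w a
    using that map_nth[of a] by (simp add: letter_def bvecs_def comp_def)
  have "computable m letter"
    unfolding letter_def by (rule computable_list) (auto intro: signals.input)
  define F where "F w = Some (\<lambda>q\<in>?Q. trans_fun D q (letter w))" for w
  have "computable m F"
    unfolding F_def by (rule computable_map) fact
  have FM: "F w \<in> insert None (Some ` carrier ?M)" for w
    using D(1,2) letter_bvecs[of w] by (auto simp: F_def transformation_monoid_carrier is_semiautomaton_def)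
  have M: "monoid ?M" by (rule transformation_monoid)
  have prod: "computable m (product ?M F)"
  proof (rule product_computable[OF M _ subset_refl \<open>computable m F\<close> FM])
    show "finite (carrier ?M)" using D(3) by (simp add: transformation_monoid_carrier finite_PiE)
  qed
  have "product ?M F w q0 = foldl (trans_fun D) q0 w" if "w \<in> lists (bvecs m)" for w
    using that
  proof (induction w rule: rev_induct)
    case Nil
    show ?case using D(4) by (simp add: transformation_monoid_one)
  next
    case (snoc a w)
    have "product ?M F w \<in> carrier ?M" using monoid.product_closed[OF M FM] .
    then have "product ?M F w q0 \<in> ?Q"
      unfolding transformation_monoid_carrier using D(4) by (rule PiE_mem)
    moreover have "product ?M F (w @ [a]) = product ?M F w \<otimes>\<^bsub>?M\<^esub> (\<lambda>q\<in>?Q. trans_fun D q a)"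
      using snoc.prems by (simp add: F_def letter)
    ultimately show ?case
      using snoc D(4) by (simp add: transformation_monoid_mult del: product_snoc)
  qed
  then have "L = {w \<in> lists (bvecs m). product ?M F w q0 \<in> T}"
    by (intro trans[OF L] Collect_cong conj_cong refl) (simp only:)
  then show thesis using computable_pred[OF prod, of "\<lambda>f. f q0 \<in> T"] that by blast
qed

text \<open>Interpretations are non-empty, so no recognised language contains the empty word; this
  is the condition \<open>[] \<notin> L\<close>.\<close>

theorem theorem5:
  "expressivity (KR_logic {A. prime_operator A}) =
     {(m, L). regular_language (bvecs m) L \<and> [] \<notin> L}"
proof (intro equalityI subsetI)
  fix x assume "x \<in> expressivity (KR_logic {A. prime_operator A})"
  then show "x \<in> {(m, L). regular_language (bvecs m) L \<and> [] \<notin> L}"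
    using recognised_language_regular
    by (auto simp: expressivity_def KR_logic_def recognised_language_def)
next
  fix x assume "x \<in> {(m, L). regular_language (bvecs m) L \<and> [] \<notin> L}"
  then obtain m L where x: "x = (m, L)" "regular_language (bvecs m) L" "[] \<notin> L" by auto
  obtain f where f: "f \<in> signals m" "L = {w \<in> lists (bvecs m). f w}"
    using regular_language_signal[OF x(2)] .
  have "L = {w \<in> lists (bvecs m). w \<noteq> [] \<and> f w}" using f(2) x(3) by auto
  then show "x \<in> expressivity (KR_logic {A. prime_operator A})"
    using signal_expressible[OF f(1)] x(1) by simp
qed

end
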